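(* Let $f(t_1,t_2)=At_1^2+Bt_1t_2+Ct_2^2$ be a primitive binary quadratic form with $A,B,C\in\mathbb{Z}$ whose Discriminant $\Delta\coloneqq B^2-4AC$ is nonzero, and suppose $f$ is isotropic, i.e. $\Delta=b^2$ for some $b\in\mathbb{Z}^+$. Then $\delta(f)>0$. More precisely, for each prime $p$ let $a_p=v_p(\Delta)$ (so each $a_p$ is even), put \[ \delta_2 \coloneqq \begin{cases} 1 & \text{if } a_2=0,\\ \frac{3}{4} & \text{if } a_2=2,\\ \frac{2+2^{4-a_2}+2^{5-a_2}+2^{2-a_2}}{12} & \text{if } a_2\geq 4,\end{cases} \] and for $p>2$ put \[ \delta_p \coloneqq \frac{p+p^{1-a_p}+2p^{-a_p}}{2p+2}. \] Then $\delta(f)=\prod_p \delta_p$, the product over all primes; moreover $\delta_p=1$ if and only if $a_p=0$, so the product may equivalently be taken over the primes dividing $\Delta$.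
   Context: A binary form is primitive if $\gcd(A,B,C)=1$. For a quadratic form $f\in\mathbb{Z}[t_1,\dots,t_n]$ let $D_f\coloneqq f(\mathbb{Z}^n)\setminus\{0\}$. For $S\subset\mathbb{Z}$: $S$ is positive if it contains no negative integers, negative if it contains no positive integers, indefinite otherwise. The density of $S$ is $\lim_{N\to\infty}\#(S\cap[1,N])/N$ if $S$ is positive, $\lim_{N\to\infty}\#(S\cap[-N,-1])/N$ if $S$ is negative, and $\lim_{N\to\infty}\#(S\cap[-N,N])/(2N)$ if $S$ is indefinite (the limit being required to exist). $\delta(f)$ denotes the density of $D_f$. $v_p$ is the $p$-adic valuation. *)

theory Defs
  imports "HOL-Analysis.Analysis" "HOL-Number_Theory.Number_Theory"
begin

definition bqf :: "int \<Rightarrow> int \<Rightarrow> int \<Rightarrow> int \<times> int \<Rightarrow> int" where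
  "bqf A B C = (\<lambda>(t1, t2). A * t1\<^sup>2 + B * t1 * t2 + C * t2\<^sup>2)"

definition primitive_bqf :: "int \<Rightarrow> int \<Rightarrow> int \<Rightarrow> bool" where
  "primitive_bqf A B C \<longleftrightarrow> Gcd {A, B, C} = 1"

definition discr :: "int \<Rightarrow> int \<Rightarrow> int \<Rightarrow> int" where
  "discr A B C = B\<^sup>2 - 4 * A * C"

definition isotropic_bqf :: "int \<Rightarrow> int \<Rightarrow> int \<Rightarrow> bool" where
  "isotropic_bqf A B C \<longleftrightarrow> (\<exists>b>0. discr A B C = b\<^sup>2)"

text \<open>For nonzero discriminant this agrees with the existence of a nontrivial zero.\<close>

lemma isotropic_bqf_iff_zero:
  assumes "discr A B C \<noteq> 0"
  shows "isotropic_bqf A B C \<longleftrightarrow> (\<exists>t. t \<noteq> (0, 0) \<and> bqf A B C t = 0)"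
proof
  assume "isotropic_bqf A B C"
  then obtain b where b: "b > 0" "discr A B C = b\<^sup>2"
    unfolding isotropic_bqf_def by blast
  show "\<exists>t. t \<noteq> (0, 0) \<and> bqf A B C t = 0"
  proof (cases "A = 0")
    case True
    then have "bqf A B C (1, 0) = 0" by (simp add: bqf_def)
    then show ?thesis by (metis one_neq_zero prod.inject)
  next
    case False
    have "bqf A B C (b - B, 2 * A) = A * (b\<^sup>2 - (B\<^sup>2 - 4 * A * C))"
      by (simp add: bqf_def power2_eq_square algebra_simps)
    also have "\<dots> = 0" using b(2) by (simp add: discr_def)
    finally show ?thesis using False by (intro exI[of _ "(b - B, 2 * A)"]) simp
  qed
next
  assume "\<exists>t. t \<noteq> (0, 0) \<and> bqf A B C t = 0"
  then obtain x y where xy: "(x, y) \<noteq> (0, 0)" "A * x\<^sup>2 + B * x * y + C * y\<^sup>2 = 0"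
    by (auto simp: bqf_def)
  have square: "isotropic_bqf A B C" if "u\<^sup>2 = discr A B C * v\<^sup>2" "v \<noteq> 0" for u v
  proof -
    have "v\<^sup>2 dvd u\<^sup>2" using that(1) by simp
    then have "v dvd u" by simp
    then obtain w where "u = v * w" by blast
    then have w: "discr A B C = w\<^sup>2"
      using that by (simp add: power_mult_distrib)
    then have "\<bar>w\<bar> > 0" using assms by auto
    with w show ?thesis unfolding isotropic_bqf_def by (metis power2_abs)
  qed
  show "isotropic_bqf A B C"
  proof (cases "y = 0")
    case False
    have "(2 * A * x + B * y)\<^sup>2 = discr A B C * y\<^sup>2 + 4 * A * (A * x\<^sup>2 + B * x * y + C * y\<^sup>2)"
      by (simp add: discr_def power2_eq_square algebra_simps)
    then show ?thesis using square[OF _ False] xy(2) by simp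
  next
    case True
    have "(2 * C * y + B * x)\<^sup>2 = discr A B C * x\<^sup>2 + 4 * C * (A * x\<^sup>2 + B * x * y + C * y\<^sup>2)"
      by (simp add: discr_def power2_eq_square algebra_simps)
    then show ?thesis using square[of _ x] True xy by simp
  qed
qed

definition nonzero_values :: "('a \<Rightarrow> int) \<Rightarrow> int set" where
  "nonzero_values f = range f - {0}"

definition positive_set :: "int set \<Rightarrow> bool" where
  "positive_set S \<longleftrightarrow> (\<forall>n\<in>S. \<not> n < 0)"

definition negative_set :: "int set \<Rightarrow> bool" where
  "negative_set S \<longleftrightarrow> (\<forall>n\<in>S. \<not> n > 0)"

text \<open>The first two cases overlap only for subsets of \<open>{0}\<close>, where both quotients vanish.\<close>

definition density_quotient :: "int set \<Rightarrow> nat \<Rightarrow> real" where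
  "density_quotient S N =
     (if positive_set S then real (card (S \<inter> {1..int N})) / real N
      else if negative_set S then real (card (S \<inter> {- int N..-1})) / real N
      else real (card (S \<inter> {- int N..int N})) / (2 * real N))"

definition has_density :: "int set \<Rightarrow> real \<Rightarrow> bool" where
  "has_density S d \<longleftrightarrow> density_quotient S \<longlonglongrightarrow> d"

text \<open>Meaningful only if the limit exists, that is, if some \<open>d\<close> satisfies \<open>has_density S d\<close>.\<close>

definition set_density :: "int set \<Rightarrow> real" where
  "set_density S = lim (density_quotient S)"

definition form_density :: "('a \<Rightarrow> int) \<Rightarrow> real" where
  "form_density f = set_density (nonzero_values f)"

text \<open>The factor at the prime \<open>p\<close> when the discriminant has valuation \<open>a\<close>. For
  square discriminants \<open>a\<close> is even, so for \<open>p = 2\<close> the last branch is the case \<open>a \<ge> 4\<close>.\<close>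

definition local_factor :: "nat \<Rightarrow> nat \<Rightarrow> real" where
  "local_factor p a =
     (if p = 2 then
        (if a = 0 then 1
         else if a = 2 then 3 / 4
         else (2 + 2 powi (4 - int a) + 2 powi (5 - int a) + 2 powi (2 - int a)) / 12)
      else (real p + real p powi (1 - int a) + 2 * real p powi (- int a)) / (2 * real p + 2))"

definition discr_val :: "int \<Rightarrow> int \<Rightarrow> int \<Rightarrow> nat \<Rightarrow> nat" where
  "discr_val A B C p = multiplicity (int p) (discr A B C)"

definition form_factor :: "int \<Rightarrow> int \<Rightarrow> int \<Rightarrow> nat \<Rightarrow> real" where
  "form_factor A B C p = local_factor p (discr_val A B C p)"

end

theory Submission
  imports Defs "HOL-Real_Asymp.Real_Asymp"
begin

text \<open>
  After a unimodular substitution the form is \<open>x (a x + b y)\<close> with \<open>a\<close> and \<open>b\<close> coprime, so \<open>n\<close> is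
  represented iff \<open>n = x z\<close> with \<open>z \<equiv> a x\<close> modulo \<open>b\<close>. Reducing modulo \<open>b\<^sup>2\<close> gives a periodic
  necessary condition, whose density is a product of local factors by the Chinese remainder
  theorem. A nonzero \<open>n\<close> satisfying this condition is represented as soon as it has divisors in
  all unit classes modulo the divisors of \<open>b\<close>, and this holds for almost all \<open>n\<close>.

  Dirichlet's theorem is not needed for the last point. Call a class \<open>g\<close> modulo \<open>q\<close> rich if almost
  all integers have a divisor in \<open>g\<close>, coprime to any prescribed number. Rich classes are closed
  under products, and a class containing primes with divergent reciprocal sum is rich. Hence the
  primes in non-rich classes have a convergent reciprocal sum, and a sieve produces in every unit
  class an integer without such prime factors; so every unit class is rich.
\<close>

section \<open>Densities of periodic sets\<close>

text \<open>The nonzero values of an isotropic form take both signs, so the symmetric case of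
  \<open>density_quotient\<close> is the one that will apply.\<close>

definition sym_count :: "int set \<Rightarrow> nat \<Rightarrow> nat" where
  "sym_count S N = card (S \<inter> {- int N..int N})"

lemma sym_count_mono: "S \<subseteq> T \<Longrightarrow> sym_count S N \<le> sym_count T N"
  unfolding sym_count_def by (intro card_mono) auto

lemma sym_count_Un: "sym_count (S \<union> T) N \<le> sym_count S N + sym_count T N"
  unfolding sym_count_def by (simp add: Int_Un_distrib2 card_Un_le)

lemma sym_count_UN:
  assumes "finite I"
  shows "sym_count (\<Union>i\<in>I. S i) N \<le> (\<Sum>i\<in>I. sym_count (S i) N)"
proof -
  have "(\<Union>i\<in>I. S i) \<inter> {- int N..int N} = (\<Union>i\<in>I. S i \<inter> {- int N..int N})"
    by auto
  then show ?thesis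
    unfolding sym_count_def using card_UN_le[OF assms, of "\<lambda>i. S i \<inter> {- int N..int N}"] by simp
qed

lemma periodic_mod_iff:
  fixes L :: int
  assumes per: "\<And>n. n + L \<in> S \<longleftrightarrow> n \<in> S"
  shows "n mod L \<in> S \<longleftrightarrow> n \<in> S"
proof -
  have nat: "n + int k * L \<in> S \<longleftrightarrow> n \<in> S" for n k
  proof (induction k)
    case (Suc k)
    have "n + int (Suc k) * L = (n + int k * L) + L" by (simp add: algebra_simps)
    then show ?case using Suc per by metis
  qed simp
  have "n + k * L \<in> S \<longleftrightarrow> n \<in> S" for n k
  proof (cases "k \<ge> 0")
    case True
    then show ?thesis using nat[of n "nat k"] by simp
  next
    case False
    then show ?thesis using nat[of "n + k * L" "nat (- k)"] by simp
  qed
  from this[of n "- (n div L)"] show ?thesis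
    by (metis add.commute add_uminus_conv_diff minus_div_mult_eq_mod mult_minus_left)
qed

lemma card_periodic_block:
  fixes L :: int
  assumes L: "L > 0" and per: "\<And>n. n + L \<in> S \<longleftrightarrow> n \<in> S"
  shows "card (S \<inter> {m..<m + L}) = card (S \<inter> {0..<L})"
proof -
  \<comment> \<open>The inverse sends a residue to its unique representative in the window that
    starts at \<open>m\<close>.\<close>
  have "bij_betw (\<lambda>n. n mod L) (S \<inter> {m..<m + L}) (S \<inter> {0..<L})"
  proof (rule bij_betw_byWitness[where f' = "\<lambda>r. m + (r - m) mod L"])
    show "\<forall>n\<in>S \<inter> {m..<m + L}. m + (n mod L - m) mod L = n"
    proof
      fix n assume "n \<in> S \<inter> {m..<m + L}"
      then have "(n - m) mod L = n - m" by simp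
      then show "m + (n mod L - m) mod L = n" by (simp add: mod_diff_left_eq)
    qed
    show "\<forall>r\<in>S \<inter> {0..<L}. (m + (r - m) mod L) mod L = r"
    proof
      fix r assume "r \<in> S \<inter> {0..<L}"
      then show "(m + (r - m) mod L) mod L = r" by (simp add: mod_add_right_eq)
    qed
    show "(\<lambda>n. n mod L) ` (S \<inter> {m..<m + L}) \<subseteq> S \<inter> {0..<L}"
      using L periodic_mod_iff[OF per] by auto
    show "(\<lambda>r. m + (r - m) mod L) ` (S \<inter> {0..<L}) \<subseteq> S \<inter> {m..<m + L}"
    proof safe
      fix r assume r: "r \<in> S" "r \<in> {0..<L}"
      have "(m + (r - m) mod L) mod L = r" using r by (simp add: mod_add_right_eq)
      then show "m + (r - m) mod L \<in> S"
        using r periodic_mod_iff[OF per, of "m + (r - m) mod L"] by simp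
      show "m + (r - m) mod L \<in> {m..<m + L}" using L by simp
    qed
  qed
  then show ?thesis by (rule bij_betw_same_card)
qed

lemma card_periodic_blocks:
  fixes L :: int
  assumes L: "L > 0" and per: "\<And>n. n + L \<in> S \<longleftrightarrow> n \<in> S"
  shows "card (S \<inter> {m..<m + int k * L}) = k * card (S \<inter> {0..<L})"
proof (induction k)
  case (Suc k)
  let ?e = "m + int k * L"
  have "m \<le> ?e" using L by simp
  moreover have "m + int (Suc k) * L = ?e + L" by (simp add: distrib_right)
  ultimately have "S \<inter> {m..<m + int (Suc k) * L} = (S \<inter> {m..<?e}) \<union> (S \<inter> {?e..<?e + L})"
    using L by (simp only: Int_Un_distrib[symmetric] ivl_disj_un_two(3) less_add_same_cancel1 less_imp_le)
  moreover have "card ((S \<inter> {m..<?e}) \<union> (S \<inter> {?e..<?e + L})) =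
      card (S \<inter> {m..<?e}) + card (S \<inter> {?e..<?e + L})"
    by (rule card_Un_disjoint) auto
  ultimately show ?case
    using Suc card_periodic_block[OF L per, of ?e] by simp
qed simp

text \<open>The \<open>2 N + 1\<close> integers of the interval contain \<open>k\<close> full
  periods and fit into \<open>k + 1\<close> of them, where \<open>k = (2 N + 1) div L\<close>; the
  error of at most one period vanishes after division by \<open>N\<close>.\<close>

lemma periodic_density:
  fixes L :: int
  assumes L: "L > 0" and per: "\<And>n. n + L \<in> S \<longleftrightarrow> n \<in> S"
  shows "(\<lambda>N. real (sym_count S N) / (2 * real N)) \<longlonglongrightarrow> card (S \<inter> {0..<L}) / real_of_int L"
proof -
  define c where "c = real (card (S \<inter> {0..<L}))"
  define l where "l = real_of_int L"
  have l: "l > 0" and c: "c \<ge> 0" using L by (auto simp: l_def c_def)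
  have bounds: "((2 * real N + 1) / l - 1) * c \<le> sym_count S N \<and>
      sym_count S N \<le> ((2 * real N + 1) / l + 1) * c" for N
  proof -
    define k where "k = nat ((2 * int N + 1) div L)"
    have k: "int k = (2 * int N + 1) div L"
      using L by (simp add: k_def pos_imp_zdiv_nonneg_iff)
    have k1: "int k * L \<le> 2 * int N + 1" using k L by (simp add: minus_mod_eq_div_mult[symmetric])
    have k2: "2 * int N + 1 < (int k + 1) * L"
      using k L by (metis add.commute distrib_right mult_1 pos_mod_bound add_strict_left_mono div_mult_mod_eq)
    have "card (S \<inter> {- int N..<- int N + int k * L}) \<le> sym_count S N"
      unfolding sym_count_def using k1 by (intro card_mono) auto
    moreover have "sym_count S N \<le> card (S \<inter> {- int N..<- int N + int (Suc k) * L})"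
      unfolding sym_count_def using k2 by (intro card_mono) (auto simp: algebra_simps)
    ultimately have "k * card (S \<inter> {0..<L}) \<le> sym_count S N"
        "sym_count S N \<le> Suc k * card (S \<inter> {0..<L})"
      by (simp_all only: card_periodic_blocks[OF L per])
    then have "real (k * card (S \<inter> {0..<L})) \<le> sym_count S N"
        "sym_count S N \<le> real (Suc k * card (S \<inter> {0..<L}))"
      by (simp_all only: of_nat_le_iff)
    then have "k * c \<le> sym_count S N" "sym_count S N \<le> (k + 1) * c"
      by (simp_all add: c_def algebra_simps)
    moreover have "real k * l \<le> 2 * real N + 1"
    proof -
      have "real_of_int (int k * L) \<le> real_of_int (2 * int N + 1)"
        using k1 by linarith
      then show ?thesis by (simp add: l_def)
    qed
    then have "real k \<le> (2 * real N + 1) / l"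
      using l by (simp add: pos_le_divide_eq)
    moreover have "2 * real N + 1 \<le> (real k + 1) * l"
    proof -
      have "real_of_int (2 * int N + 1) \<le> real_of_int ((int k + 1) * L)"
        using k2 by linarith
      then show ?thesis by (simp add: l_def)
    qed
    then have "(2 * real N + 1) / l \<le> real k + 1"
      using l by (simp add: pos_divide_le_eq)
    ultimately have k: "k * c \<le> sym_count S N" "sym_count S N \<le> (k + 1) * c"
        "(2 * real N + 1) / l - 1 \<le> k" "k + 1 \<le> (2 * real N + 1) / l + 1"
      by simp_all
    then show ?thesis
      using mult_right_mono[OF k(3) c] mult_right_mono[OF k(4) c] by linarith
  qed
  have "(\<lambda>N. real (sym_count S N) / (2 * real N)) \<longlonglongrightarrow> inverse l * c"
  proof (rule tendsto_sandwich)
    show "\<forall>\<^sub>F N in sequentially. ((2 * real N + 1) / l - 1) * c / (2 * real N)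
        \<le> real (sym_count S N) / (2 * real N)"
      using bounds by (intro always_eventually allI divide_right_mono) auto
    show "\<forall>\<^sub>F N in sequentially. real (sym_count S N) / (2 * real N)
        \<le> ((2 * real N + 1) / l + 1) * c / (2 * real N)"
      using bounds by (intro always_eventually allI divide_right_mono) auto
    show "(\<lambda>N. ((2 * real N + 1) / l - 1) * c / (2 * real N)) \<longlonglongrightarrow> inverse l * c"
      using l by real_asymp
    show "(\<lambda>N. ((2 * real N + 1) / l + 1) * c / (2 * real N)) \<longlonglongrightarrow> inverse l * c"
      using l by real_asymp
  qed
  then show ?thesis unfolding c_def l_def by (subst divide_inverse_commute)
qed

section \<open>Divisors in prescribed residue classes\<close>

lemma coprime_prod_primes_iff:
  fixes n :: int and P :: "nat set"
  assumes "finite P" "\<And>p. p \<in> P \<Longrightarrow> prime p"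
  shows "coprime n (int (\<Prod>P)) \<longleftrightarrow> (\<forall>p\<in>P. \<not> int p dvd n)"
proof -
  have "coprime n (int p) \<longleftrightarrow> \<not> int p dvd n" if "p \<in> P" for p
    using assms(2)[OF that] by (metis coprime_commute prime_imp_coprime prime_nat_int_transfer
        coprime_absorb_left not_prime_unit)
  moreover have "coprime n (int (\<Prod>P)) \<longleftrightarrow> (\<forall>p\<in>P. coprime n (int p))"
    using assms(1) by (induction P rule: finite_induct) auto
  ultimately show ?thesis by blast
qed

text \<open>Avoiding the primes of \<open>P\<close> means being coprime to their product
  \<open>L\<close>, a condition of period \<open>L\<close>, so the density is
  \<open>totient L / L\<close>.\<close>

lemma density_avoiding_primes:
  fixes P :: "nat set"
  assumes fin: "finite P" and pr: "\<And>p. p \<in> P \<Longrightarrow> prime p"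
  shows "(\<lambda>N. real (sym_count {n. \<forall>p\<in>P. \<not> int p dvd n} N) / (2 * real N))
    \<longlonglongrightarrow> (\<Prod>p\<in>P. 1 - 1 / real p)"
proof -
  define L where "L = \<Prod>P"
  define S where "S = {n. \<forall>p\<in>P. \<not> int p dvd n}"
  have L: "L > 0" unfolding L_def using pr by (intro prod_pos) (auto intro: prime_gt_0_nat)
  have S: "S = {n. coprime n (int L)}"
    using coprime_prod_primes_iff[OF assms] by (simp add: S_def L_def)
  have per: "n + int L \<in> S \<longleftrightarrow> n \<in> S" for n
    by (simp add: S coprime_iff_gcd_eq_1)
  \<comment> \<open>\<open>totatives\<close> lie between \<open>1\<close> and \<open>L\<close>,
    hence a window starting at \<open>1\<close>; periodicity then moves it to
    \<open>0\<close>.\<close>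
  have "S \<inter> {1..<1 + int L} = int ` totatives L"
  proof (intro equalityI subsetI)
    fix n assume n: "n \<in> S \<inter> {1..<1 + int L}"
    then have "nat n \<in> totatives L" "n = int (nat n)"
      by (auto simp: S in_totatives_iff simp flip: coprime_int_iff)
    then show "n \<in> int ` totatives L" by blast
  qed (auto simp: S in_totatives_iff)
  then have "card (S \<inter> {1..<1 + int L}) = totient L"
    by (simp add: card_image totient_def)
  then have c: "card (S \<inter> {0..<int L}) = totient L"
    using card_periodic_block[of "int L" S 1] L per by simp
  have "prime_factors L = P"
  proof (intro equalityI subsetI)
    fix p assume "p \<in> prime_factors L"
    then have p: "prime p" "p dvd L" by auto
    then obtain r where "r \<in> P" "p dvd r"
      using fin by (auto simp: L_def prime_dvd_prod_iff)
    then show "p \<in> P" using pr p primes_dvd_imp_eq by blast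
  next
    fix p assume "p \<in> P"
    then show "p \<in> prime_factors L"
      using pr fin L dvd_prodI[OF fin, of p "\<lambda>x. x"]
      by (auto simp: in_prime_factors_iff L_def)
  qed
  then have "real (totient L) / real L = (\<Prod>p\<in>P. 1 - 1 / real p)"
    using totient_formula2[of L] L by simp
  then show ?thesis
    using periodic_density[of "int L" S] L per c by (simp add: S_def)
qed

text \<open>A finite sieve for every tolerance \<open>\<epsilon>\<close> expresses that almost all
  integers have a divisor in the class. The free modulus \<open>M\<close> lets divisors be chosen
  coprime to earlier ones, and in the end coprime to \<open>b\<close>.\<close>

definition rich_class :: "int \<Rightarrow> int \<Rightarrow> bool" where
  "rich_class q g \<longleftrightarrow> (\<forall>\<epsilon>>0. \<forall>M>0. \<exists>D. finite D \<and>
     (\<forall>d\<in>D. 0 < d \<and> [d = g] (mod q) \<and> coprime d M) \<and>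
     (\<forall>\<^sub>F N in sequentially.
        real (sym_count {n. \<forall>d\<in>D. \<not> d dvd n} N) / (2 * real N) < \<epsilon>))"

lemma rich_classE:
  assumes "rich_class q g" "\<epsilon> > 0" "M > 0"
  obtains D where "finite D" "\<And>d. d \<in> D \<Longrightarrow> 0 < d"
    "\<And>d. d \<in> D \<Longrightarrow> [d = g] (mod q)" "\<And>d. d \<in> D \<Longrightarrow> coprime d M"
    "\<forall>\<^sub>F N in sequentially. real (sym_count {n. \<forall>d\<in>D. \<not> d dvd n} N) / (2 * real N) < \<epsilon>"
proof -
  obtain D where "finite D \<and> (\<forall>d\<in>D. 0 < d \<and> [d = g] (mod q) \<and> coprime d M) \<and>
     (\<forall>\<^sub>F N in sequentially. real (sym_count {n. \<forall>d\<in>D. \<not> d dvd n} N) / (2 * real N) < \<epsilon>)"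
    using assms unfolding rich_class_def by presburger
  then show ?thesis using that by blast
qed

lemma rich_class_cong:
  assumes "[g = h] (mod q)"
  shows "rich_class q g \<longleftrightarrow> rich_class q h"
proof -
  have "[d = g] (mod q) \<longleftrightarrow> [d = h] (mod q)" for d
    using assms by (simp add: cong_def)
  then show ?thesis by (simp add: rich_class_def)
qed

lemma rich_class_1: "rich_class q 1"
  unfolding rich_class_def
proof (intro allI impI exI[of _ "{1}"] conjI ballI)
  fix \<epsilon> :: real assume "\<epsilon> > 0"
  then show "\<forall>\<^sub>F N in sequentially.
      real (sym_count {n. \<forall>d\<in>{1}. \<not> d dvd n} N) / (2 * real N) < \<epsilon>"
    by (simp add: sym_count_def)
qed auto

text \<open>The divisors for \<open>h\<close> are chosen coprime to those for \<open>g\<close>; if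
  \<open>n\<close> has one of each, their product divides \<open>n\<close>. So a failure for
  \<open>g * h\<close> is a failure for \<open>g\<close> or for \<open>h\<close>, and each gets half
  of the tolerance.\<close>

lemma rich_class_mult:
  assumes "rich_class q g" "rich_class q h"
  shows "rich_class q (g * h)"
  unfolding rich_class_def
proof (intro allI impI)
  fix \<epsilon> :: real and M :: int
  assume \<epsilon>: "\<epsilon> > 0" and M: "M > 0"
  obtain D where D: "finite D" "\<And>d. d \<in> D \<Longrightarrow> 0 < d"
    "\<And>d. d \<in> D \<Longrightarrow> [d = g] (mod q)" "\<And>d. d \<in> D \<Longrightarrow> coprime d M"
    "\<forall>\<^sub>F N in sequentially. real (sym_count {n. \<forall>d\<in>D. \<not> d dvd n} N) / (2 * real N) < \<epsilon> / 2"
    using rich_classE[OF assms(1), of "\<epsilon> / 2" M] \<epsilon> M by auto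
  \<comment> \<open>The factor \<open>\<Prod>D\<close> in the modulus is what makes every element of
    \<open>E\<close> coprime to every element of \<open>D\<close>.\<close>
  have "M * \<Prod>D > 0" using D(2) M by (simp add: prod_pos)
  then obtain E where E: "finite E" "\<And>d. d \<in> E \<Longrightarrow> 0 < d"
    "\<And>d. d \<in> E \<Longrightarrow> [d = h] (mod q)" "\<And>d. d \<in> E \<Longrightarrow> coprime d (M * \<Prod>D)"
    "\<forall>\<^sub>F N in sequentially. real (sym_count {n. \<forall>d\<in>E. \<not> d dvd n} N) / (2 * real N) < \<epsilon> / 2"
    using rich_classE[OF assms(2), of "\<epsilon> / 2" "M * \<Prod>D"] \<epsilon> by auto
  define F where "F = (\<lambda>(d, e). d * e) ` (D \<times> E)"
  have cop: "coprime d e" if "d \<in> D" "e \<in> E" for d e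
  proof -
    have "d dvd \<Prod>D" using dvd_prodI[OF D(1) that(1), of "\<lambda>x. x"] by simp
    then show ?thesis using E(4)[OF that(2)]
      by (meson coprime_commute coprime_divisors dvd_refl dvd_mult)
  qed
  have sub: "{n. \<forall>d\<in>F. \<not> d dvd n} \<subseteq> {n. \<forall>d\<in>D. \<not> d dvd n} \<union> {n. \<forall>d\<in>E. \<not> d dvd n}"
    using cop by (auto simp: F_def) (meson divides_mult)
  show "\<exists>D. finite D \<and> (\<forall>d\<in>D. 0 < d \<and> [d = g * h] (mod q) \<and> coprime d M) \<and>
     (\<forall>\<^sub>F N in sequentially.
        real (sym_count {n. \<forall>d\<in>D. \<not> d dvd n} N) / (2 * real N) < \<epsilon>)"
  proof (intro exI[of _ F] conjI)
    show "finite F" using D(1) E(1) by (simp add: F_def)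
    show "\<forall>d\<in>F. 0 < d \<and> [d = g * h] (mod q) \<and> coprime d M"
      using D(2-4) E(2-4) unfolding F_def by (fastforce intro: cong_mult)
    show "\<forall>\<^sub>F N in sequentially.
        real (sym_count {n. \<forall>d\<in>F. \<not> d dvd n} N) / (2 * real N) < \<epsilon>"
      using D(5) E(5)
    proof eventually_elim
      case (elim N)
      have "sym_count {n. \<forall>d\<in>F. \<not> d dvd n} N \<le>
        sym_count {n. \<forall>d\<in>D. \<not> d dvd n} N + sym_count {n. \<forall>d\<in>E. \<not> d dvd n} N"
        by (rule order.trans[OF sym_count_mono[OF sub] sym_count_Un])
      then have "real (sym_count {n. \<forall>d\<in>F. \<not> d dvd n} N) \<le>
        real (sym_count {n. \<forall>d\<in>D. \<not> d dvd n} N) + real (sym_count {n. \<forall>d\<in>E. \<not> d dvd n} N)"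
        by linarith
      then have "real (sym_count {n. \<forall>d\<in>F. \<not> d dvd n} N) / (2 * real N) \<le>
        real (sym_count {n. \<forall>d\<in>D. \<not> d dvd n} N) / (2 * real N) +
        real (sym_count {n. \<forall>d\<in>E. \<not> d dvd n} N) / (2 * real N)"
        by (simp add: add_divide_distrib[symmetric] divide_right_mono)
      with elim show ?case by linarith
    qed
  qed
qed

text \<open>The divisors are primes of the class itself. The integers avoiding finitely many of them
  have density the product of \<open>1 - 1 / p\<close>, at most the exponential of minus the
  reciprocal sum, and divergence makes this smaller than \<open>\<epsilon>\<close>.\<close>

lemma rich_class_divergent:
  assumes div: "\<not> summable (\<lambda>p. if prime p \<and> [int p = g] (mod q) then 1 / real p else 0)"
  shows "rich_class q g"
  unfolding rich_class_def
proof (intro allI impI)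
  fix \<epsilon> :: real and M :: int
  assume \<epsilon>: "\<epsilon> > 0" and M: "M > 0"
  let ?h = "\<lambda>p. if prime p \<and> [int p = g] (mod q) then 1 / real p else 0"
  \<comment> \<open>Starting beyond \<open>M\<close> preserves divergence and keeps the remaining
    primes from dividing \<open>M\<close>.\<close>
  define m where "m = nat M + 1"
  have "\<not> summable (\<lambda>p. ?h (p + m))" using div summable_iff_shift[of ?h m] by blast
  then obtain k where k: "(\<Sum>i<k. ?h (i + m)) > - ln \<epsilon>"
  proof -
    have "\<not> summable (\<lambda>p. ?h (p + m)) \<Longrightarrow> \<exists>k. (\<Sum>i<k. ?h (i + m)) > - ln \<epsilon>"
      by (rule ccontr) (auto simp: not_less intro!: summableI_nonneg_bounded[of _ "- ln \<epsilon>"])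
    then show ?thesis using that \<open>\<not> summable (\<lambda>p. ?h (p + m))\<close> by blast
  qed
  define P where "P = {p \<in> {m..<k + m}. prime p \<and> [int p = g] (mod q)}"
  have "(\<Sum>i<k. ?h (i + m)) = (\<Sum>p\<in>{m..<k + m}. ?h p)"
    using sum.shift_bounds_nat_ivl[of ?h 0 m k] by (simp add: lessThan_atLeast0)
  also have "\<dots> = (\<Sum>p\<in>P. 1 / real p)"
    unfolding P_def by (subst sum.inter_filter) auto
  finally have P: "(\<Sum>p\<in>P. 1 / real p) > - ln \<epsilon>" using k by simp
  have finP: "finite P" and prP: "\<And>p. p \<in> P \<Longrightarrow> prime p" by (auto simp: P_def)
  have "(\<Prod>p\<in>P. 1 - 1 / real p) \<le> (\<Prod>p\<in>P. exp (- (1 / real p)))"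
  proof (rule prod_mono)
    fix p assume "p \<in> P"
    then have "real p \<ge> 1" using prP prime_ge_1_nat by fastforce
    then show "0 \<le> 1 - 1 / real p \<and> 1 - 1 / real p \<le> exp (- (1 / real p))"
      using exp_ge_add_one_self[of "- (1 / real p)"] by simp
  qed
  also have "\<dots> = exp (- (\<Sum>p\<in>P. 1 / real p))"
    using finP by (simp add: exp_sum flip: sum_negf)
  also have "\<dots> < exp (ln \<epsilon>)" using P by simp
  finally have lt: "(\<Prod>p\<in>P. 1 - 1 / real p) < \<epsilon>" using \<epsilon> by simp
  show "\<exists>D. finite D \<and> (\<forall>d\<in>D. 0 < d \<and> [d = g] (mod q) \<and> coprime d M) \<and>
     (\<forall>\<^sub>F N in sequentially.
        real (sym_count {n. \<forall>d\<in>D. \<not> d dvd n} N) / (2 * real N) < \<epsilon>)"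
  proof (intro exI[of _ "int ` P"] conjI ballI)
    show "finite (int ` P)" using finP by simp
    show "\<forall>\<^sub>F N in sequentially.
        real (sym_count {n. \<forall>d\<in>int ` P. \<not> d dvd n} N) / (2 * real N) < \<epsilon>"
      using order_tendstoD(2)[OF density_avoiding_primes[OF finP prP] lt] by simp
  next
    fix d assume "d \<in> int ` P"
    then obtain p where p: "d = int p" "p \<in> P" by blast
    show "0 < d" using p prP prime_gt_0_nat by auto
    show "[d = g] (mod q)" using p by (simp add: P_def)
    have "int p > M" using p M by (auto simp: P_def m_def)
    then have "\<not> int p dvd M" using M zdvd_not_zless by blast
    then show "coprime d M"
      using p prP by (simp add: prime_imp_coprime)
  qed
qed

section \<open>A sieve for primes with convergent reciprocal sum\<close>

lemma summable_tail_sum_less: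
  fixes h :: "nat \<Rightarrow> real"
  assumes "summable h" "\<And>i. h i \<ge> 0" "\<epsilon> > 0"
  obtains z where "\<And>F. finite F \<Longrightarrow> F \<subseteq> {z..} \<Longrightarrow> sum h F < \<epsilon>"
proof -
  obtain z where z: "norm (\<Sum>i. h (i + z)) < \<epsilon>"
    using suminf_exist_split[OF assms(3,1)] by blast
  have s: "summable (\<lambda>i. h (i + z))" using assms(1) by (simp add: summable_iff_shift)
  have "sum h F < \<epsilon>" if F: "finite F" "F \<subseteq> {z..}" for F
  proof -
    have "sum h F = (\<Sum>i\<in>(\<lambda>n. n - z) ` F. h (i + z))"
      by (rule sum.reindex_bij_witness[of _ "\<lambda>i. i + z" "\<lambda>n. n - z"]) (use F in auto)
    also have "\<dots> \<le> (\<Sum>i. h (i + z))"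
      using F s assms(2) by (intro sum_le_suminf) auto
    finally show ?thesis using z by simp
  qed
  then show ?thesis using that by blast
qed

text \<open>Since \<open>c\<close> is invertible modulo \<open>p\<close>, the condition determines
  \<open>m\<close> modulo \<open>p\<close>, so each block of \<open>p\<close> consecutive indices
  contains at most one solution; \<open>m div p\<close> numbers the blocks.\<close>

lemma card_progression_multiples_le:
  fixes p X :: nat and n0 c :: nat
  assumes "prime p" "\<not> p dvd c" "X > 0"
  shows "card {m \<in> {..<X}. p dvd n0 + c * m} \<le> Suc ((X - 1) div p)"
proof -
  let ?M = "{m \<in> {..<X}. p dvd n0 + c * m}"
  have "inj_on (\<lambda>m. m div p) ?M"
  proof (rule inj_onI)
    fix m m' assume m: "m \<in> ?M" "m' \<in> ?M" "m div p = m' div p"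
    have "[n0 + c * m = n0 + c * m'] (mod p)"
      using m by (simp add: cong_def mod_eq_0_iff_dvd[THEN iffD2])
    then have "[c * m = c * m'] (mod p)" by (simp add: cong_add_lcancel_nat)
    moreover have "coprime c p"
      using prime_imp_coprime[OF assms(1,2)] by (simp add: coprime_commute)
    ultimately have "[m = m'] (mod p)" by (simp add: cong_mult_lcancel_nat)
    then show "m = m'" using m(3) by (metis cong_def div_mult_mod_eq)
  qed
  moreover have "(\<lambda>m. m div p) ` ?M \<subseteq> {..(X - 1) div p}"
    using assms(3) by (auto intro!: div_le_mono)
  ultimately have "card ?M \<le> card {..(X - 1) div p}"
    by (intro card_inj_on_le) auto
  then show ?thesis by simp
qed

text \<open>Sieve the terms \<open>n0 + c * m\<close> with \<open>m < X\<close>. The primes of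
  \<open>P\<close> below \<open>z\<close> are excluded by the choice of \<open>n0\<close>. A prime
  \<open>p\<close> between \<open>z\<close> and \<open>X\<close> divides at most
  \<open>2 X / p\<close> terms; one between \<open>X\<close> and \<open>2 c X\<close> divides at
  most one, and \<open>1\<close> is at most \<open>2 c X / p\<close>. The tails are so small that
  each range removes at most a quarter of the terms.\<close>

lemma exists_cong_avoiding_sparse_primes:
  fixes q g :: nat and P :: "nat set"
  assumes q: "q > 0"
    and P: "\<And>p. p \<in> P \<Longrightarrow> prime p" "\<And>p. p \<in> P \<Longrightarrow> \<not> p dvd q"
    and summ: "summable (\<lambda>p. if p \<in> P then 1 / real p else 0)"
  shows "\<exists>n. [n = g] (mod q) \<and> n > 0 \<and> (\<forall>p\<in>P. \<not> p dvd n)"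
proof (rule ccontr)
  assume none: "\<nexists>n. [n = g] (mod q) \<and> n > 0 \<and> (\<forall>p\<in>P. \<not> p dvd n)"
  define h where "h = (\<lambda>p. if p \<in> P then 1 / real p else 0)"
  have h: "summable h" "\<And>p. h p \<ge> 0" using summ by (auto simp: h_def)
  obtain z where z: "\<And>F. finite F \<Longrightarrow> F \<subseteq> {z..} \<Longrightarrow> sum h F < 1 / 8"
    using summable_tail_sum_less[OF h, of "1 / 8"] by auto
  define K where "K = \<Prod>(P \<inter> {..<z})"
  define c where "c = q * K"
  have K: "K > 0" unfolding K_def using P(1) by (intro prod_pos) (auto intro: prime_gt_0_nat)
  have c: "c > 0" using q K by (simp add: c_def)
  have "coprime q K"
    unfolding K_def using P by (intro prod_coprime_right) (auto simp: coprime_commute prime_imp_coprime)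
  then obtain n1 where n1: "[n1 = g] (mod q)" "[n1 = 1] (mod K)"
    using binary_chinese_remainder_nat by blast
  \<comment> \<open>Adding \<open>c\<close> makes \<open>n0\<close> positive, and
    \<open>n0 < 2 * c\<close> later bounds every term by \<open>2 * c * X\<close>.\<close>
  define n0 where "n0 = n1 mod c + c"
  have n0: "[n0 = g] (mod q)" "[n0 = 1] (mod K)" "n0 > 0" "n0 < 2 * c"
    using n1 c mod_less_divisor[OF c, of n1]
    by (auto simp: n0_def cong_def) (simp_all add: c_def mod_mod_cancel)
  obtain z' where z': "\<And>F. finite F \<Longrightarrow> F \<subseteq> {z'..} \<Longrightarrow> sum h F < 1 / (8 * real c)"
    using summable_tail_sum_less[OF h, of "1 / (8 * real c)"] c by auto
  \<comment> \<open>With this choice every prime beyond \<open>X\<close> lies in the tail controlled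
    by \<open>z'\<close>.\<close>
  define X where "X = z' + 1"
  have X: "X > 0" by (simp add: X_def)
  \<comment> \<open>Every term is congruent to \<open>1\<close> modulo \<open>K\<close>, so a prime
    of \<open>P\<close> dividing a term cannot be one of the factors of \<open>K\<close>.\<close>
  have large: "z \<le> p \<and> p \<le> 2 * c * X \<and> \<not> p dvd c" if p: "p \<in> P" "p dvd n0 + c * m" "m < X" for p m
  proof -
    have notK: "\<not> p dvd K"
    proof
      assume "p dvd K"
      then have "p dvd n0" using p(2) by (metis c_def dvd_add_left_iff dvd_mult dvd_mult2)
      moreover have "[n0 = 1] (mod p)" using n0(2) \<open>p dvd K\<close> cong_dvd_modulus_nat by blast
      ultimately have "p dvd 1" using cong_dvd_iff by blast
      then show False using P(1)[OF p(1)] by simp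
    qed
    have "z \<le> p"
    proof (rule ccontr)
      assume "\<not> z \<le> p"
      then have "p dvd K"
        unfolding K_def using p(1) dvd_prodI[of "P \<inter> {..<z}" p "\<lambda>x. x"] by simp
      then show False using notK by simp
    qed
    moreover have "p \<le> n0 + c * m" using p(2) n0(3) by (intro dvd_imp_le) auto
    moreover have "c * m + c \<le> c * X" using p(3) by (metis Suc_leI add.commute mult_Suc_right mult_le_mono2)
    moreover have "c \<le> c * X" using X by simp
    ultimately have "z \<le> p" "p \<le> 2 * c * X" using n0(4) by linarith+
    moreover have "\<not> p dvd c"
      using notK P p(1) by (simp add: c_def prime_dvd_mult_iff)
    ultimately show ?thesis by blast
  qed
  define F1 where "F1 = P \<inter> {z..X}"
  define F2 where "F2 = P \<inter> {X<..2 * c * X}"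
  \<comment> \<open>The conjunct \<open>\<not> p dvd c\<close> makes \<open>M p\<close> empty when
    \<open>p\<close> divides \<open>c\<close>, so the counting bounds below hold for every
    \<open>p\<close>.\<close>
  define M where "M = (\<lambda>p. {m \<in> {..<X}. \<not> p dvd c \<and> p dvd n0 + c * m})"
  have "{..<X} \<subseteq> (\<Union>p\<in>F1 \<union> F2. M p)"
  proof
    fix m assume m: "m \<in> {..<X}"
    have "[n0 + c * m = g] (mod q)" using n0(1) by (simp add: c_def cong_def mult.assoc)
    then obtain p where "p \<in> P" "p dvd n0 + c * m" using none n0(3) by auto
    then have "p \<in> F1 \<union> F2" "m \<in> M p"
      using large[of p m] m by (auto simp: F1_def F2_def M_def not_le)
    then show "m \<in> (\<Union>p\<in>F1 \<union> F2. M p)" by blast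
  qed
  then have "card {..<X} \<le> card (\<Union>p\<in>F1 \<union> F2. M p)"
    by (rule card_mono[rotated]) (auto simp: F1_def F2_def M_def)
  also have "\<dots> \<le> (\<Sum>p\<in>F1 \<union> F2. card (M p))"
    by (rule card_UN_le) (auto simp: F1_def F2_def)
  also have "\<dots> = (\<Sum>p\<in>F1. card (M p)) + (\<Sum>p\<in>F2. card (M p))"
    by (rule sum.union_disjoint) (auto simp: F1_def F2_def)
  finally have "real X \<le> real ((\<Sum>p\<in>F1. card (M p)) + (\<Sum>p\<in>F2. card (M p)))"
    by (simp only: card_lessThan of_nat_le_iff)
  also have "\<dots> = (\<Sum>p\<in>F1. real (card (M p))) + (\<Sum>p\<in>F2. real (card (M p)))"
    by simp
  also have "(\<Sum>p\<in>F1. real (card (M p))) \<le> (\<Sum>p\<in>F1. 2 * real X * h p)"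
  proof (rule sum_mono)
    fix p assume p: "p \<in> F1"
    then have pr: "prime p" and pX: "p \<le> X" and hp: "h p = 1 / real p"
      using P by (auto simp: F1_def h_def)
    have pos: "p > 0" using pr prime_gt_0_nat by blast
    have "card (M p) \<le> Suc ((X - 1) div p)"
      using card_progression_multiples_le[OF pr _ X, of c n0] by (cases "p dvd c") (auto simp: M_def)
    also have "\<dots> \<le> Suc (X div p)" by (simp add: div_le_mono)
    finally have "real (card (M p)) \<le> real (X div p) + 1" by linarith
    also have "\<dots> \<le> real X / real p + real X / real p"
      using pos pX of_nat_div_le_of_nat[of X p] by (intro add_mono) auto
    finally show "real (card (M p)) \<le> 2 * real X * h p" by (simp add: hp)
  qed
  also have "(\<Sum>p\<in>F1. 2 * real X * h p) = 2 * real X * sum h F1"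
    by (simp add: sum_distrib_left)
  also have "(\<Sum>p\<in>F2. real (card (M p))) \<le> (\<Sum>p\<in>F2. 2 * real c * real X * h p)"
  proof (rule sum_mono)
    fix p assume p: "p \<in> F2"
    then have pr: "prime p" and pX: "p > X" and pc: "p \<le> 2 * c * X" and hp: "h p = 1 / real p"
      using P by (auto simp: F2_def h_def)
    have pos: "p > 0" using pr prime_gt_0_nat by blast
    have "card (M p) \<le> Suc ((X - 1) div p)"
      using card_progression_multiples_le[OF pr _ X, of c n0] by (cases "p dvd c") (auto simp: M_def)
    \<comment> \<open>For \<open>p > X\<close> all indices lie in a single block, so
      \<open>p\<close> divides at most one term.\<close>
    also have "(X - 1) div p = 0" using pX by simp
    finally have "real (card (M p)) \<le> 1" by simp
    also have "real p \<le> 2 * real c * real X"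
      using pc by (metis of_nat_le_iff of_nat_mult of_nat_numeral)
    then have "1 \<le> 2 * real c * real X / real p" using pos by simp
    finally show "real (card (M p)) \<le> 2 * real c * real X * h p" by (simp add: hp)
  qed
  also have "(\<Sum>p\<in>F2. 2 * real c * real X * h p) = 2 * real c * real X * sum h F2"
    by (simp add: sum_distrib_left)
  finally have "real X \<le> 2 * real X * sum h F1 + 2 * real c * real X * sum h F2"
    by simp
  also have "2 * real X * sum h F1 \<le> 2 * real X * (1 / 8)"
    by (intro mult_left_mono less_imp_le[OF z]) (auto simp: F1_def)
  also have "2 * real c * real X * sum h F2 \<le> 2 * real c * real X * (1 / (8 * real c))"
    by (intro mult_left_mono less_imp_le[OF z']) (auto simp: F2_def X_def)
  finally show False using X c by simp
qed

text \<open>The primes of a class that is not rich have a convergent reciprocal sum, and there are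
  finitely many classes, so the sieve gives a member \<open>n\<close> of the class of
  \<open>g\<close> all of whose prime factors lie in rich classes. Multiplying these classes gives
  the class of \<open>n\<close>.\<close>

theorem rich_class_coprime:
  fixes q g :: int
  assumes q: "q > 0" and g: "coprime g q"
  shows "rich_class q g"
proof -
  define P where "P = {p. prime p \<and> \<not> p dvd nat q \<and> \<not> rich_class q (int p)}"
  define R where "R = {r \<in> {0..<q}. \<not> rich_class q r}"
  let ?f = "\<lambda>r p. if prime p \<and> [int p = r] (mod q) then 1 / real p else 0"
  have finR: "finite R" by (rule finite_subset[of _ "{0..<q}"]) (auto simp: R_def)
  have "summable (\<lambda>p. \<Sum>r\<in>R. ?f r p)"
    using rich_class_divergent by (intro summable_sum) (auto simp: R_def)
  then have summ: "summable (\<lambda>p. if p \<in> P then 1 / real p else 0)"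
  proof (rule summable_comparison_test[rotated], intro exI allI impI)
    fix p :: nat
    have nn: "0 \<le> ?f r p" for r by simp
    show "norm (if p \<in> P then 1 / real p else 0) \<le> (\<Sum>r\<in>R. ?f r p)"
    proof (cases "p \<in> P")
      case True
      have cg: "[int p = int p mod q] (mod q)" by (simp add: cong_def)
      then have "int p mod q \<in> R"
        using True q rich_class_cong[OF cg] by (auto simp: P_def R_def)
      then have "?f (int p mod q) p \<le> (\<Sum>r\<in>R. ?f r p)"
        using finR by (intro member_le_sum) auto
      then show ?thesis using True cg by (simp add: P_def)
    qed (use nn in \<open>auto intro!: sum_nonneg\<close>)
  qed
  have "\<exists>n. [n = nat (g mod q)] (mod nat q) \<and> n > 0 \<and> (\<forall>p\<in>P. \<not> p dvd n)"
  proof (rule exists_cong_avoiding_sparse_primes[OF _ _ _ summ])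
    show "nat q > 0" using q by simp
    show "prime p" "\<not> p dvd nat q" if "p \<in> P" for p using that by (auto simp: P_def)
  qed
  then obtain n where n: "[n = nat (g mod q)] (mod nat q)" "n > 0" "\<forall>p\<in>P. \<not> p dvd n"
    by blast
  have ng: "[int n = g] (mod q)"
    using n(1) q by (simp add: cong_int_iff[symmetric] cong_def)
  have cop: "coprime n (nat q)"
    using ng g q by (metis cong_imp_coprime cong_sym coprime_int_iff int_nat_eq less_imp_le)
  \<comment> \<open>Passing to all divisors of \<open>n\<close> lets the induction over prime
    factors go through.\<close>
  have "rich_class q (int m)" if "m dvd n" for m
    using that n(2)
  proof (induction m rule: prime_divisors_induct)
    case (factor p m)
    have "\<not> p dvd nat q"
      using factor.prems factor.hyps cop
      by (metis coprime_common_divisor dvd_mult_left not_prime_unit dvd_trans)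
    moreover have "p \<notin> P" using n(3) factor.prems dvd_mult_left by blast
    ultimately have "rich_class q (int p)" using factor.hyps by (simp add: P_def)
    moreover have "rich_class q (int m)" using factor dvd_mult_right by blast
    ultimately show ?case using rich_class_mult by simp
  qed (auto simp: rich_class_1)
  from this[of n] rich_class_cong[OF ng] show ?thesis by simp
qed

section \<open>Values modulo the squared modulus\<close>

text \<open>\<open>z\<close> stands for the second factor \<open>a * x + q * y\<close>. The modulus
  for \<open>n\<close> is a square because removing a common prime from \<open>x\<close>,
  \<open>z\<close> and \<open>q\<close> removes its square from \<open>n\<close>.\<close>

definition local_values :: "int \<Rightarrow> int \<Rightarrow> int set" where
  "local_values a q = {n. \<exists>x z. [n = x * z] (mod q\<^sup>2) \<and> [z = a * x] (mod q)}"

definition local_count :: "int \<Rightarrow> int \<Rightarrow> nat" where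
  "local_count a q = card (local_values a q \<inter> {0..<q\<^sup>2})"

lemma local_values_cong:
  assumes "[n = m] (mod q\<^sup>2)"
  shows "n \<in> local_values a q \<longleftrightarrow> m \<in> local_values a q"
proof -
  have "[n = y] (mod q\<^sup>2) \<longleftrightarrow> [m = y] (mod q\<^sup>2)" for y
    using assms by (simp add: cong_def)
  then show ?thesis by (simp add: local_values_def)
qed

lemma local_values_periodic: "n + q\<^sup>2 \<in> local_values a q \<longleftrightarrow> n \<in> local_values a q"
  by (rule local_values_cong) (simp add: cong_def)

text \<open>The Chinese remainder theorem glues \<open>x\<close> and \<open>z\<close> separately
  modulo the squares; these congruences imply those modulo \<open>q\<close> and \<open>r\<close>, so
  both conditions survive.\<close>

lemma local_values_mult:
  assumes cop: "coprime q r"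
  shows "n \<in> local_values a (q * r) \<longleftrightarrow> n \<in> local_values a q \<and> n \<in> local_values a r"
proof
  assume "n \<in> local_values a (q * r)"
  then obtain x z where xz: "[n = x * z] (mod (q * r)\<^sup>2)" "[z = a * x] (mod (q * r))"
    by (auto simp: local_values_def)
  have "[n = x * z] (mod q\<^sup>2)" "[n = x * z] (mod r\<^sup>2)" "[z = a * x] (mod q)" "[z = a * x] (mod r)"
    using xz by (auto elim: cong_dvd_modulus simp: power_mult_distrib)
  then show "n \<in> local_values a q \<and> n \<in> local_values a r"
    by (auto simp: local_values_def)
next
  assume "n \<in> local_values a q \<and> n \<in> local_values a r"
  then obtain x1 z1 x2 z2 where
    1: "[n = x1 * z1] (mod q\<^sup>2)" "[z1 = a * x1] (mod q)" and
    2: "[n = x2 * z2] (mod r\<^sup>2)" "[z2 = a * x2] (mod r)"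
    by (auto simp: local_values_def)
  have cop2: "coprime (q\<^sup>2) (r\<^sup>2)" using cop by simp
  obtain x where x: "[x = x1] (mod q\<^sup>2)" "[x = x2] (mod r\<^sup>2)"
    using binary_chinese_remainder_int[OF cop2] by blast
  obtain z where z: "[z = z1] (mod q\<^sup>2)" "[z = z2] (mod r\<^sup>2)"
    using binary_chinese_remainder_int[OF cop2] by blast
  have low: "[x = x1] (mod q)" "[x = x2] (mod r)" "[z = z1] (mod q)" "[z = z2] (mod r)"
    using x z by (auto elim: cong_dvd_modulus)
  have "[n = x * z] (mod q\<^sup>2)" "[n = x * z] (mod r\<^sup>2)"
    using 1(1) 2(1) x z by (meson cong_mult cong_sym cong_trans)+
  then have "[n = x * z] (mod (q * r)\<^sup>2)"
    using coprime_cong_mult[OF _ _ cop2] by (simp add: power_mult_distrib)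
  moreover have "[z = a * x] (mod q)" "[z = a * x] (mod r)"
    using 1(2) 2(2) low by (meson cong_scalar_left cong_sym cong_trans)+
  then have "[z = a * x] (mod (q * r))"
    using coprime_cong_mult[OF _ _ cop] by simp
  ultimately show "n \<in> local_values a (q * r)"
    by (auto simp: local_values_def)
qed

lemma local_count_mult:
  assumes cop: "coprime q r" and q: "q > 0" and r: "r > 0"
  shows "local_count a (q * r) = local_count a q * local_count a r"
proof -
  let ?h = "\<lambda>n::int. (n mod q\<^sup>2, n mod r\<^sup>2)"
  let ?A = "local_values a (q * r) \<inter> {0..<(q * r)\<^sup>2}"
  let ?B = "(local_values a q \<inter> {0..<q\<^sup>2}) \<times> (local_values a r \<inter> {0..<r\<^sup>2})"
  have cop2: "coprime (q\<^sup>2) (r\<^sup>2)" using cop by simp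
  have m: "n mod q\<^sup>2 \<in> local_values a q \<longleftrightarrow> n \<in> local_values a q" for n q
    by (rule local_values_cong) (simp add: cong_def)
  have inj: "inj_on ?h ?A"
  proof (rule inj_onI)
    fix n k assume nk: "n \<in> ?A" "k \<in> ?A" "?h n = ?h k"
    have "[n = k] (mod q\<^sup>2 * r\<^sup>2)"
      using nk(3) by (intro coprime_cong_mult[OF _ _ cop2]) (simp_all add: cong_def)
    then have "[n = k] (mod (q * r)\<^sup>2)" by (simp add: power_mult_distrib)
    then show "n = k" using nk by (auto intro: cong_less_imp_eq_int)
  qed
  have img: "?h ` ?A = ?B"
  proof (intro equalityI subsetI)
    fix y assume "y \<in> ?h ` ?A"
    then show "y \<in> ?B" using q r by (auto simp: m local_values_mult[OF cop])
  next
    fix y assume "y \<in> ?B"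
    then obtain y1 y2 where y: "y = (y1, y2)" "y1 \<in> local_values a q" "y1 \<in> {0..<q\<^sup>2}"
      "y2 \<in> local_values a r" "y2 \<in> {0..<r\<^sup>2}" by auto
    obtain n where n: "[n = y1] (mod q\<^sup>2)" "[n = y2] (mod r\<^sup>2)"
      using binary_chinese_remainder_int[OF cop2] by blast
    define k where "k = n mod (q * r)\<^sup>2"
    have k: "[k = y1] (mod q\<^sup>2)" "[k = y2] (mod r\<^sup>2)"
      using n by (simp_all add: k_def cong_def power_mult_distrib mod_mod_cancel)
    then have "k \<in> local_values a (q * r)"
      using y local_values_cong[OF k(1)] local_values_cong[OF k(2)] by (simp add: local_values_mult[OF cop])
    moreover have "k \<in> {0..<(q * r)\<^sup>2}" using q r by (simp add: k_def)
    moreover have "?h k = y" using k y by (simp add: cong_def)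
    ultimately show "y \<in> ?h ` ?A" by blast
  qed
  have "card ?A = card ?B" using card_image[OF inj] by (simp only: img)
  then show ?thesis by (simp add: local_count_def card_cartesian_product)
qed

section \<open>Local values at prime powers\<close>

definition unit_squares :: "int \<Rightarrow> int set" where
  "unit_squares q = {r \<in> {0..<q}. \<exists>u. coprime u q \<and> [r = u\<^sup>2] (mod q)}"

lemma finite_unit_squares [simp]: "finite (unit_squares q)"
  by (rule finite_subset[of _ "{0..<q}"]) (auto simp: unit_squares_def)

text \<open>When \<open>p\<close> does not divide \<open>n\<close>, the factor \<open>x\<close> is a
  unit, and modulo \<open>Q\<close> the two conditions collapse into one. Conversely, prescribe
  \<open>x = u\<close> and solve \<open>u * z = n\<close> modulo \<open>Q^2\<close>; cancelling
  \<open>u\<close> then gives the congruence for \<open>z\<close>.\<close>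

lemma local_values_unit_iff:
  fixes p :: nat
  assumes p: "prime p" and n: "\<not> int p dvd n" and Q: "Q = int p ^ Suc k"
  shows "n \<in> local_values a Q \<longleftrightarrow> (\<exists>u. coprime u Q \<and> [n = a * u\<^sup>2] (mod Q))"
proof
  assume "n \<in> local_values a Q"
  then obtain x z where xz: "[n = x * z] (mod Q\<^sup>2)" "[z = a * x] (mod Q)"
    by (auto simp: local_values_def)
  have "[n = x * z] (mod Q)" using xz(1) by (rule cong_dvd_modulus) simp
  also have "[x * z = x * (a * x)] (mod Q)" using xz(2) by (rule cong_scalar_left)
  finally have n': "[n = a * x\<^sup>2] (mod Q)" by (simp add: power2_eq_square mult_ac)
  have "[n = a * x\<^sup>2] (mod int p)" using n' by (rule cong_dvd_modulus) (simp add: Q)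
  then have "\<not> int p dvd x"
    using n by (metis cong_dvd_iff dvd_mult dvd_power dvd_trans zero_less_numeral)
  then have "coprime (int p) x" using p by (intro prime_imp_coprime) auto
  then have "coprime x Q" unfolding Q by (simp add: coprime_commute)
  with n' show "\<exists>u. coprime u Q \<and> [n = a * u\<^sup>2] (mod Q)" by blast
next
  assume "\<exists>u. coprime u Q \<and> [n = a * u\<^sup>2] (mod Q)"
  then obtain u where u: "coprime u Q" "[n = a * u\<^sup>2] (mod Q)" by blast
  then obtain w where w: "[u * w = 1] (mod Q\<^sup>2)"
    using cong_solve_coprime_int[of u "Q\<^sup>2"] by auto
  define z where "z = w * n"
  have "[u * z = n] (mod Q\<^sup>2)"
    using cong_scalar_right[OF w, of n] by (simp add: z_def mult.assoc)
  then have z: "[n = u * z] (mod Q\<^sup>2)" by (rule cong_sym)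
  have "[u * z = n] (mod Q)" using cong_sym[OF z] by (rule cong_dvd_modulus) simp
  also note u(2)
  finally have "[u * z = u * (a * u)] (mod Q)" by (simp add: power2_eq_square mult_ac)
  then have "[z = a * u] (mod Q)" using u(1) cong_mult_lcancel by blast
  with z show "n \<in> local_values a Q" by (auto simp: local_values_def)
qed

text \<open>If \<open>p\<close> divides \<open>n\<close>, it divides \<open>x\<close> or
  \<open>z\<close>, hence both, because \<open>z\<close> is congruent to \<open>x\<close> times the
  unit \<open>a\<close>. Dividing both by \<open>p\<close> takes \<open>p^2\<close> out of
  \<open>n\<close> and one \<open>p\<close> out of the modulus.\<close>

lemma local_values_nonunit:
  fixes p :: nat
  assumes p: "prime p" and a: "coprime a (int p)" and n: "int p dvd n"
  shows "n \<in> local_values a (int p ^ Suc k) \<longleftrightarrow>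
    (\<exists>m. n = (int p)\<^sup>2 * m \<and> m \<in> local_values a (int p ^ k))"
proof
  let ?Q = "int p ^ Suc k"
  have p0: "int p \<noteq> 0" using p by auto
  assume "n \<in> local_values a ?Q"
  then obtain x z where xz: "[n = x * z] (mod ?Q\<^sup>2)" "[z = a * x] (mod ?Q)"
    by (auto simp: local_values_def)
  have "[n = x * z] (mod int p)" using xz(1) by (rule cong_dvd_modulus) (simp add: power2_eq_square)
  then have "int p dvd x * z" using n cong_dvd_iff by blast
  moreover have zp: "[z = a * x] (mod int p)" using xz(2) by (rule cong_dvd_modulus) simp
  then have "int p dvd z \<longleftrightarrow> int p dvd x"
    using cong_dvd_iff[OF zp] a by (simp add: coprime_dvd_mult_right_iff coprime_commute)
  ultimately have "int p dvd x" "int p dvd z"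
    using p by (auto simp: prime_dvd_mult_iff)
  then obtain x' z' where x': "x = int p * x'" "z = int p * z'" by (auto elim!: dvdE)
  have Q2: "?Q\<^sup>2 = (int p)\<^sup>2 * (int p ^ k)\<^sup>2" by (simp add: power_mult_distrib)
  have "(int p)\<^sup>2 dvd n - x * z" using xz(1) unfolding Q2 cong_iff_dvd_diff by (rule dvd_mult_left)
  moreover have "(int p)\<^sup>2 dvd x * z" by (simp add: x' power2_eq_square)
  ultimately have "(int p)\<^sup>2 dvd n" by (metis dvd_diff_left_iff)
  then obtain m where m: "n = (int p)\<^sup>2 * m" by blast
  have "n - x * z = (int p)\<^sup>2 * (m - x' * z')"
    by (simp add: m x' power2_eq_square algebra_simps)
  then have "[m = x' * z'] (mod (int p ^ k)\<^sup>2)"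
    using xz(1) p0 unfolding Q2 cong_iff_dvd_diff by simp
  moreover have "z - a * x = int p * (z' - a * x')" by (simp add: x' algebra_simps)
  then have "[z' = a * x'] (mod (int p ^ k))"
    using xz(2) p0 unfolding cong_iff_dvd_diff by simp
  ultimately show "\<exists>m. n = (int p)\<^sup>2 * m \<and> m \<in> local_values a (int p ^ k)"
    using m by (auto simp: local_values_def)
next
  assume "\<exists>m. n = (int p)\<^sup>2 * m \<and> m \<in> local_values a (int p ^ k)"
  then obtain m x z where m: "n = (int p)\<^sup>2 * m"
    "[m = x * z] (mod (int p ^ k)\<^sup>2)" "[z = a * x] (mod (int p ^ k))"
    by (auto simp: local_values_def)
  have "n - (int p * x) * (int p * z) = (int p)\<^sup>2 * (m - x * z)"
    by (simp add: m power2_eq_square algebra_simps)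
  then have "[n = (int p * x) * (int p * z)] (mod (int p ^ Suc k)\<^sup>2)"
    using m(2) by (simp add: cong_iff_dvd_diff power_mult_distrib mult_dvd_mono)
  moreover have "int p * z - a * (int p * x) = int p * (z - a * x)" by (simp add: algebra_simps)
  then have "[int p * z = a * (int p * x)] (mod (int p ^ Suc k))"
    using m(3) by (simp add: cong_iff_dvd_diff mult_dvd_mono)
  ultimately show "n \<in> local_values a (int p ^ Suc k)"
    unfolding local_values_def by blast
qed

text \<open>Multiplication by the unit \<open>a\<close> permutes the residues modulo
  \<open>q\<close>.\<close>

lemma card_scaled_unit_squares:
  assumes a: "coprime a q" and q: "q > 0"
  shows "card ({n. \<exists>u. coprime u q \<and> [n = a * u\<^sup>2] (mod q)} \<inter> {0..<q}) = card (unit_squares q)"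
    (is "card ?W = _")
proof -
  have "inj_on (\<lambda>r. a * r mod q) (unit_squares q)"
  proof (rule inj_onI)
    fix r s assume rs: "r \<in> unit_squares q" "s \<in> unit_squares q" "a * r mod q = a * s mod q"
    then have "[r = s] (mod q)" using cong_mult_lcancel[OF a] by (simp add: cong_def)
    then show "r = s" using rs by (auto simp: unit_squares_def intro: cong_less_imp_eq_int)
  qed
  moreover have "(\<lambda>r. a * r mod q) ` unit_squares q = ?W"
  proof (intro equalityI subsetI)
    fix n assume "n \<in> (\<lambda>r. a * r mod q) ` unit_squares q"
    then obtain r u where r: "n = a * r mod q" "coprime u q" "[r = u\<^sup>2] (mod q)"
      by (auto simp: unit_squares_def)
    have "[n = a * u\<^sup>2] (mod q)" using cong_scalar_left[OF r(3), of a] r(1) by (simp add: cong_def)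
    then show "n \<in> ?W" using r q by auto
  next
    fix n assume "n \<in> ?W"
    then obtain u where u: "coprime u q" "[n = a * u\<^sup>2] (mod q)" "n \<in> {0..<q}" by blast
    have "u\<^sup>2 mod q \<in> unit_squares q"
      using u(1) q by (auto simp: unit_squares_def cong_def)
    moreover have "n = a * (u\<^sup>2 mod q) mod q"
      using u(2,3) by (simp add: cong_def mod_mult_right_eq)
    ultimately show "n \<in> (\<lambda>r. a * r mod q) ` unit_squares q" by blast
  qed
  ultimately show ?thesis by (metis card_image)
qed

text \<open>The residues divisible by \<open>p\<close> are \<open>p^2\<close> times the local values
  for the exponent \<open>k\<close>. The others are described by a condition modulo
  \<open>Q\<close>, so each of the \<open>Q\<close> blocks of length \<open>Q\<close> below
  \<open>Q^2\<close> contributes the number of unit squares.\<close>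

lemma local_count_prime_power_Suc:
  fixes p :: nat
  assumes p: "prime p" and a: "coprime a (int p)"
  shows "local_count a (int p ^ Suc k) =
    local_count a (int p ^ k) + p ^ Suc k * card (unit_squares (int p ^ Suc k))"
proof -
  define Q where "Q = int p ^ Suc k"
  define A where "A = {n \<in> local_values a Q \<inter> {0..<Q\<^sup>2}. int p dvd n}"
  define B where "B = {n \<in> local_values a Q \<inter> {0..<Q\<^sup>2}. \<not> int p dvd n}"
  define S where "S = {n. \<exists>u. coprime u Q \<and> [n = a * u\<^sup>2] (mod Q)}"
  have p0: "int p > 0" using p prime_gt_0_nat by simp
  have Q0: "Q > 0" using p0 by (simp add: Q_def)
  have aQ: "coprime a Q" using a by (simp add: Q_def)
  have "local_values a Q \<inter> {0..<Q\<^sup>2} = A \<union> B" by (auto simp: A_def B_def)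
  then have "local_count a Q = card (A \<union> B)" by (simp add: local_count_def)
  also have "\<dots> = card A + card B"
    by (rule card_Un_disjoint) (auto simp: A_def B_def intro: finite_subset[of _ "{0..<Q\<^sup>2}"])
  also have "A = (\<lambda>m. (int p)\<^sup>2 * m) ` (local_values a (int p ^ k) \<inter> {0..<(int p ^ k)\<^sup>2})"
  proof (intro equalityI subsetI)
    fix n assume n: "n \<in> A"
    then obtain m where m: "n = (int p)\<^sup>2 * m" "m \<in> local_values a (int p ^ k)"
      using local_values_nonunit[OF p a, of n k] by (auto simp: A_def Q_def)
    have "0 \<le> (int p)\<^sup>2 * m" "(int p)\<^sup>2 * m < (int p)\<^sup>2 * (int p ^ k)\<^sup>2"
      using n by (auto simp: A_def Q_def m(1) power_mult_distrib)
    then have "m \<in> {0..<(int p ^ k)\<^sup>2}" using p0 by (simp add: zero_le_mult_iff)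
    then show "n \<in> (\<lambda>m. (int p)\<^sup>2 * m) ` (local_values a (int p ^ k) \<inter> {0..<(int p ^ k)\<^sup>2})"
      using m by blast
  next
    fix n assume "n \<in> (\<lambda>m. (int p)\<^sup>2 * m) ` (local_values a (int p ^ k) \<inter> {0..<(int p ^ k)\<^sup>2})"
    then obtain m where m: "n = (int p)\<^sup>2 * m" "m \<in> local_values a (int p ^ k)"
      "m \<in> {0..<(int p ^ k)\<^sup>2}" by blast
    then have m': "0 \<le> m" "m < (int p ^ k)\<^sup>2" by auto
    have dv: "int p dvd n" by (simp add: m(1) power2_eq_square)
    moreover have "n \<in> local_values a Q"
      using local_values_nonunit[OF p a dv, of k] m by (auto simp: Q_def)
    moreover have "(int p)\<^sup>2 * m < (int p)\<^sup>2 * (int p ^ k)\<^sup>2" using m'(2) p0 by simp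
    ultimately show "n \<in> A" using m(1) m'(1) by (simp add: A_def Q_def power_mult_distrib)
  qed
  also have "card \<dots> = local_count a (int p ^ k)"
    using p0 by (subst card_image) (auto simp: inj_on_def local_count_def)
  \<comment> \<open>The interval below \<open>Q^2\<close> is written as \<open>nat Q\<close> blocks
    to fit \<open>card_periodic_blocks\<close>.\<close>
  also have "B = S \<inter> {0..<0 + int (nat Q) * Q}"
  proof -
    have "\<not> int p dvd n" if n: "n \<in> S" for n
    proof
      assume dv: "int p dvd n"
      obtain u where u: "coprime u Q" "[n = a * u\<^sup>2] (mod Q)" using n by (auto simp: S_def)
      have "[n = a * u\<^sup>2] (mod int p)" using u(2) by (rule cong_dvd_modulus) (simp add: Q_def)
      then have "int p dvd a * u\<^sup>2" using dv cong_dvd_iff by blast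
      moreover have "coprime (a * u\<^sup>2) (int p)" using u(1) a by (simp add: Q_def)
      ultimately show False
        using p by (metis coprime_common_divisor dvd_refl not_prime_unit prime_nat_int_transfer)
    qed
    then have "B = S \<inter> {0..<Q\<^sup>2}"
      using local_values_unit_iff[OF p _ Q_def, of _ a] by (auto simp: B_def S_def)
    then show ?thesis using Q0 by (simp add: power2_eq_square)
  qed
  also have "card \<dots> = nat Q * card (S \<inter> {0..<Q})"
    by (rule card_periodic_blocks[OF Q0]) (simp add: S_def cong_def)
  also have "card (S \<inter> {0..<Q}) = card (unit_squares Q)"
    unfolding S_def by (rule card_scaled_unit_squares[OF aQ Q0])
  finally show ?thesis by (simp add: Q_def nat_power_eq nat_mult_distrib)
qed

section \<open>Counting unit squares\<close>

text \<open>\<open>p\<close> cannot divide both factors of \<open>u^2 - v^2\<close>, since it would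
  divide their sum \<open>2 * u\<close>; so one factor is coprime to \<open>p\<close> and the other
  absorbs the whole power.\<close>

lemma dvd_power_diff_of_square_cong:
  fixes p :: nat and u v :: int
  assumes p: "prime p" "odd p" and u: "\<not> int p dvd u"
    and uv: "[u\<^sup>2 = v\<^sup>2] (mod int p ^ k)"
  shows "int p ^ k dvd u - v \<or> int p ^ k dvd u + v"
proof -
  have dv: "int p ^ k dvd (u - v) * (u + v)"
    using uv by (simp add: cong_iff_dvd_diff power2_eq_square algebra_simps)
  have "\<not> (int p dvd u - v \<and> int p dvd u + v)"
  proof
    assume "int p dvd u - v \<and> int p dvd u + v"
    then have "int p dvd (u - v) + (u + v)" by (blast intro: dvd_add)
    then have "int p dvd 2 * u" by simp
    moreover have "\<not> int p dvd 2"
      using p by (metis int_dvd_int_iff of_nat_numeral primes_dvd_imp_eq two_is_prime_nat even_numeral)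
    ultimately show False
      using u p by (auto simp: prime_dvd_mult_iff)
  qed
  then have "coprime (int p ^ k) (u - v) \<or> coprime (int p ^ k) (u + v)"
    using p by (metis coprime_power_left_iff prime_imp_coprime prime_nat_int_transfer)
  then show ?thesis
    using dv by (auto simp: coprime_dvd_mult_left_iff coprime_dvd_mult_right_iff)
qed

text \<open>Squaring identifies exactly \<open>u\<close> and \<open>- u\<close>. The set
  \<open>H\<close> takes from each such pair the member below \<open>Q / 2\<close>, so there are
  half as many unit squares as units.\<close>

lemma card_unit_squares_odd_prime_power:
  fixes p :: nat
  assumes p: "prime p" "odd p"
  shows "2 * card (unit_squares (int p ^ Suc k)) = p ^ k * (p - 1)"
proof -
  define Q where "Q = int p ^ Suc k"
  define H where "H = {u. 0 < u \<and> 2 * u < Q \<and> coprime u Q}"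
  have Q0: "Q > 1" using prime_gt_1_nat[OF p(1)] unfolding Q_def by (intro one_less_power) auto
  have oddQ: "odd Q" using p by (simp add: Q_def)
  have dvd_iff: "coprime u Q \<longleftrightarrow> \<not> int p dvd u" for u
  proof -
    have "coprime u Q \<longleftrightarrow> coprime (int p) u" by (auto simp: Q_def coprime_commute)
    then show ?thesis
      using p prime_imp_coprime[of "int p" u] coprime_absorb_left[of "int p" u] by auto
  qed
  have "int p dvd Q" by (simp add: Q_def)
  then have refl: "coprime (Q - u) Q \<longleftrightarrow> coprime u Q" for u
    by (simp add: dvd_iff dvd_diff_right_iff)
  have finH: "finite H" by (rule finite_subset[of _ "{0..<Q}"]) (auto simp: H_def)
  have inj: "inj_on (\<lambda>u. u\<^sup>2 mod Q) H"
  proof (rule inj_onI)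
    fix u v assume uv: "u \<in> H" "v \<in> H" "u\<^sup>2 mod Q = v\<^sup>2 mod Q"
    then have "Q dvd u - v \<or> Q dvd u + v"
      unfolding Q_def using dvd_iff
      by (intro dvd_power_diff_of_square_cong[OF p]) (auto simp: H_def cong_def Q_def)
    \<comment> \<open>Both numbers are positive and below \<open>Q / 2\<close>, so their sum lies
      strictly between \<open>0\<close> and \<open>Q\<close>.\<close>
    moreover have "\<not> Q dvd u + v"
      using uv by (intro zdvd_not_zless) (auto simp: H_def)
    ultimately have "[u = v] (mod Q)" by (simp add: cong_iff_dvd_diff)
    then show "u = v" using uv by (auto simp: H_def intro!: cong_less_imp_eq_int)
  qed
  have img: "(\<lambda>u. u\<^sup>2 mod Q) ` H = unit_squares Q"
  proof (intro equalityI subsetI)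
    fix r assume "r \<in> (\<lambda>u. u\<^sup>2 mod Q) ` H"
    then show "r \<in> unit_squares Q"
      using Q0 by (auto simp: unit_squares_def H_def cong_def)
  next
    fix r assume "r \<in> unit_squares Q"
    then obtain u where u: "coprime u Q" "[r = u\<^sup>2] (mod Q)" "r \<in> {0..<Q}"
      by (auto simp: unit_squares_def)
    define w where "w = u mod Q"
    have w: "coprime w Q" "0 \<le> w" "w < Q" "[r = w\<^sup>2] (mod Q)"
      using u Q0 by (auto simp: w_def cong_def power_mod coprime_iff_gcd_eq_1 gcd.commute simp flip: gcd_red_int)
    \<comment> \<open>The representative of \<open>u\<close> or \<open>- u\<close> in the lower
      half.\<close>
    define v where "v = (if 2 * w < Q then w else Q - w)"
    have "w \<noteq> 0" using w(1) Q0 by auto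
    moreover have "2 * w \<noteq> Q" using oddQ by auto
    moreover have "coprime v Q"
      using w(1) refl by (simp add: v_def)
    ultimately have "v \<in> H" using w by (auto simp: H_def v_def)
    moreover have "[v\<^sup>2 = w\<^sup>2] (mod Q)"
    proof (cases "2 * w < Q")
      case False
      have "(Q - w)\<^sup>2 - w\<^sup>2 = Q * (Q - 2 * w)" by (simp add: power2_eq_square algebra_simps)
      then show ?thesis using False by (simp add: v_def cong_iff_dvd_diff)
    qed (simp add: v_def)
    then have "r = v\<^sup>2 mod Q" using w(4) u(3) by (simp add: cong_def)
    ultimately show "r \<in> (\<lambda>u. u\<^sup>2 mod Q) ` H" by blast
  qed
  have "card (unit_squares Q) = card H" using card_image[OF inj] by (simp only: img)
  moreover have "2 * card H = totient (p ^ Suc k)"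
  proof -
    let ?H' = "(\<lambda>u. Q - u) ` H"
    have Qn: "Q = int (p ^ Suc k)" by (simp add: Q_def)
    have "int ` totatives (p ^ Suc k) = H \<union> ?H'"
    proof (intro equalityI subsetI)
      fix u assume "u \<in> int ` totatives (p ^ Suc k)"
      then have u: "0 < u" "u \<le> Q" "coprime u Q"
        by (auto simp: in_totatives_iff Qn simp del: power_Suc of_nat_power)
      have "u \<noteq> Q" using u(3) Q0 by auto
      moreover have "2 * u \<noteq> Q" using oddQ by auto
      ultimately have "2 * u < Q \<or> 2 * (Q - u) < Q \<and> 0 < Q - u" using u by auto
      then consider "2 * u < Q" | "2 * (Q - u) < Q" "0 < Q - u" by blast
      then show "u \<in> H \<union> ?H'"
      proof cases
        case 2
        then have "Q - u \<in> H" using u refl by (simp add: H_def)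
        moreover have "u = Q - (Q - u)" by simp
        ultimately show ?thesis by blast
      qed (use u in \<open>auto simp: H_def\<close>)
    next
      fix u assume "u \<in> H \<union> ?H'"
      then have "0 < u" "u < Q" "coprime u Q" using refl by (auto simp: H_def)
      then have "nat u \<in> totatives (p ^ Suc k)" "u = int (nat u)"
        by (auto simp: in_totatives_iff Qn simp del: power_Suc of_nat_power simp flip: coprime_int_iff)
      then show "u \<in> int ` totatives (p ^ Suc k)" by blast
    qed
    then have "totient (p ^ Suc k) = card (H \<union> ?H')"
      by (metis totient_def card_image inj_on_of_nat)
    also have "\<dots> = card H + card ?H'"
      using finH by (intro card_Un_disjoint) (auto simp: H_def)
    also have "card ?H' = card H" by (intro card_image) (auto simp: inj_on_def)
    finally show ?thesis by simp
  qed
  ultimately show ?thesis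
    using totient_prime_power_Suc[OF p(1), of k] by (simp add: Q_def)
qed

section \<open>Unit squares modulo powers of two\<close>

lemma two_power_dvd_cancel_singly_even:
  fixes x y :: int
  assumes "2 ^ Suc m dvd x * y" "even y" "\<not> 4 dvd y"
  shows "2 ^ m dvd x"
proof -
  obtain w where w: "y = 2 * w" using assms(2) by blast
  then have "odd w" using assms(3) by auto
  then have "coprime (2 ^ m) w" by simp
  moreover have "2 * 2 ^ m dvd 2 * (x * w)" using assms(1) by (simp add: w mult_ac)
  then have "2 ^ m dvd x * w" by (subst (asm) dvd_mult_cancel_left) simp
  ultimately show ?thesis by (simp add: coprime_dvd_mult_left_iff)
qed

text \<open>Two odd numbers have the same square modulo \<open>Q = 2^(k+3)\<close> iff they agree up
  to sign modulo \<open>R = Q / 2\<close>. The set \<open>H\<close> represents these classes by the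
  odd numbers below \<open>R / 2 = 2^(k+1)\<close>.\<close>

lemma card_unit_squares_power_two: "card (unit_squares (2 ^ (k + 3))) = 2 ^ k"
proof -
  define Q :: int where "Q = 2 ^ (k + 3)"
  define R :: int where "R = 2 ^ (k + 2)"
  define H where "H = {u::int. 0 < u \<and> 2 * u < R \<and> odd u}"
  have QR: "Q = 2 * R" by (simp add: Q_def R_def power_add)
  have R: "even R" "R > 0" "4 dvd R" by (simp_all add: R_def)
  have cop: "coprime u Q \<longleftrightarrow> odd u" for u
    by (simp add: Q_def)
  have inj: "inj_on (\<lambda>u. u\<^sup>2 mod Q) H"
  proof (rule inj_onI)
    fix u v assume uv: "u \<in> H" "v \<in> H" "u\<^sup>2 mod Q = v\<^sup>2 mod Q"
    then have "Q dvd u\<^sup>2 - v\<^sup>2" by (simp add: mod_eq_dvd_iff)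
    then have dv: "2 ^ Suc (k + 2) dvd (u - v) * (u + v)"
      by (simp add: Q_def power_add power2_eq_square algebra_simps)
    have ev: "even (u - v)" "even (u + v)" using uv by (auto simp: H_def)
    \<comment> \<open>The even numbers \<open>u - v\<close> and \<open>u + v\<close> add up to
      \<open>2 * u\<close> with \<open>u\<close> odd, so \<open>4\<close> divides only one of them,
      and that one is divisible by \<open>R\<close>. As \<open>u + v\<close> lies between
      \<open>0\<close> and \<open>R\<close>, it must be the difference.\<close>
    have "\<not> R dvd u + v" using uv by (intro zdvd_not_zless) (auto simp: H_def)
    then have "4 dvd u - v"
      using two_power_dvd_cancel_singly_even[of "k + 2" "u + v" "u - v"] dv ev
      by (auto simp: R_def mult.commute)
    moreover have "\<not> 4 dvd 2 * u" using uv by (auto simp: H_def)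
    then have "\<not> 4 dvd (u - v) + (u + v)" by simp
    ultimately have "\<not> 4 dvd u + v" using dvd_add by blast
    then have "R dvd u - v"
      using two_power_dvd_cancel_singly_even[OF dv ev(2)] by (simp add: R_def)
    then have "[u = v] (mod R)" by (simp add: cong_iff_dvd_diff)
    then show "u = v" using uv by (auto simp: H_def intro!: cong_less_imp_eq_int)
  qed
  have img: "(\<lambda>u. u\<^sup>2 mod Q) ` H = unit_squares Q"
  proof (intro equalityI subsetI)
    fix r assume "r \<in> (\<lambda>u. u\<^sup>2 mod Q) ` H"
    then show "r \<in> unit_squares Q"
      using R by (auto simp: unit_squares_def H_def cong_def cop QR[symmetric]) (simp_all add: QR)
  next
    fix r assume "r \<in> unit_squares Q"
    then obtain u where u: "odd u" "[r = u\<^sup>2] (mod Q)" "r \<in> {0..<Q}"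
      by (auto simp: unit_squares_def cop)
    define w where "w = u mod R"
    have w: "0 \<le> w" "w < R" using R by (simp_all add: w_def)
    have uw: "u = w + R * (u div R)" by (simp add: w_def)
    then have "odd w" using u(1) R(1) by (metis dvd_add_right_iff dvd_mult2)
    define v where "v = (if 2 * w < R then w else R - w)"
    have "2 * w \<noteq> R"
      using \<open>odd w\<close> R(3) by auto
    moreover have "w \<noteq> 0" using \<open>odd w\<close> by auto
    ultimately have vH: "v \<in> H" using w R \<open>odd w\<close> by (auto simp: H_def v_def)
    have "\<exists>t. u = v + R * t \<or> u = - v + R * t"
    proof (cases "2 * w < R")
      case True
      then show ?thesis using uw by (auto simp: v_def)
    next
      case False
      then have "u = - v + R * (u div R + 1)" using uw by (simp add: v_def algebra_simps)
      then show ?thesis by blast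
    qed
    then obtain t where "u = v + R * t \<or> u = - v + R * t" by blast
    then have "u\<^sup>2 - v\<^sup>2 = Q * (v * t) + R * R * t\<^sup>2 \<or> u\<^sup>2 - v\<^sup>2 = Q * (- v * t) + R * R * t\<^sup>2"
    proof (elim disj_forward)
      assume u: "u = v + R * t"
      show "u\<^sup>2 - v\<^sup>2 = Q * (v * t) + R * R * t\<^sup>2"
        unfolding u by (simp add: power2_eq_square QR algebra_simps)
    next
      assume u: "u = - v + R * t"
      show "u\<^sup>2 - v\<^sup>2 = Q * (- v * t) + R * R * t\<^sup>2"
        unfolding u by (simp add: power2_eq_square QR algebra_simps)
    qed
    \<comment> \<open>Evenness of \<open>R\<close> makes the term quadratic in \<open>t\<close>
      vanish modulo \<open>Q\<close>.\<close>
    moreover have "Q dvd R * R" unfolding QR using R(1) by (intro mult_dvd_mono) auto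
    ultimately have "Q dvd u\<^sup>2 - v\<^sup>2" by (metis dvd_add dvd_mult2 dvd_triv_left)
    then have "[u\<^sup>2 = v\<^sup>2] (mod Q)" by (simp add: cong_iff_dvd_diff)
    then have "r = v\<^sup>2 mod Q" using u by (simp add: cong_def)
    then show "r \<in> (\<lambda>u. u\<^sup>2 mod Q) ` H" using vH by blast
  qed
  have H: "H = (\<lambda>i. 2 * i + 1) ` {0..<2 ^ k}"
  proof (intro equalityI subsetI)
    fix u assume u: "u \<in> H"
    then have "u = 2 * (u div 2) + 1" by (simp add: H_def)
    moreover have "u div 2 \<in> {0..<2 ^ k}" using u by (auto simp: H_def R_def)
    ultimately show "u \<in> (\<lambda>i. 2 * i + 1) ` {0..<2 ^ k}" by blast
  qed (auto simp: H_def R_def)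
  have "card (unit_squares Q) = card H" using card_image[OF inj] by (simp only: img)
  also have "\<dots> = card {0..<2 ^ k :: int}" unfolding H by (intro card_image) (auto simp: inj_on_def)
  finally show ?thesis by (simp add: Q_def nat_power_eq)
qed

text \<open>The moduli \<open>2\<close> and \<open>4\<close> lie below the range of the formula for
  \<open>2 ^ (k + 3)\<close>.\<close>

lemma unit_squares_two: "unit_squares 2 = {1}"
proof -
  have "r \<in> unit_squares 2 \<longleftrightarrow> r = 1" for r
  proof
    assume "r \<in> unit_squares 2"
    then obtain u where u: "r \<in> {0..<2}" "odd u" "[r = u\<^sup>2] (mod 2)" by (auto simp: unit_squares_def)
    then have "odd r" by (auto dest: cong_dvd_iff)
    then show "r = 1" using u(1) by (cases "r = 0") auto
  qed (auto simp: unit_squares_def intro!: exI[of _ 1])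
  then show ?thesis by blast
qed

lemma unit_squares_four: "unit_squares 4 = {1}"
proof -
  have "r \<in> unit_squares 4 \<longleftrightarrow> r = 1" for r
  proof
    assume "r \<in> unit_squares 4"
    then obtain u where u: "r \<in> {0..<4}" "coprime u 4" "[r = u\<^sup>2] (mod 4)"
      by (auto simp: unit_squares_def)
    have "odd u" using u(2) by (metis coprime_common_divisor dvd_triv_left mult_2 numeral_Bit0 odd_one)
    then obtain w where "u = 2 * w + 1" by (auto elim: oddE)
    then have "u\<^sup>2 - 1 = 4 * (w * w + w)" by (simp add: power2_eq_square algebra_simps)
    then have "[u\<^sup>2 = 1] (mod 4)" by (simp add: cong_iff_dvd_diff)
    then have "[r = 1] (mod 4)" using u(3) cong_trans by blast
    then show "r = 1" using u(1) by (simp add: cong_def)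
  qed (auto simp: unit_squares_def intro!: exI[of _ 1])
  then show ?thesis by blast
qed

section \<open>Evaluation of the local counts\<close>

lemma local_count_1: "local_count a 1 = 1"
proof -
  have "local_values a 1 \<inter> {0..<1\<^sup>2} = {0}" by (auto simp: local_values_def)
  then show ?thesis by (simp add: local_count_def)
qed

text \<open>Passing from \<open>k\<close> to \<open>k + 1\<close> adds
  \<open>p^(k+1) * p^k * (p - 1) / 2\<close>. Multiplied by \<open>2 p + 2\<close> this telescopes
  as \<open>p * p^(2k+2) - p * p^(2k)\<close>, and the count \<open>1\<close> at exponent
  \<open>0\<close> gives the constant \<open>p + 2\<close>.\<close>

lemma local_count_odd_prime_power:
  fixes p :: nat
  assumes p: "prime p" "odd p" and a: "coprime a (int p)"
  shows "real (local_count a (int p ^ k)) * (2 * real p + 2) = real p * (real p ^ k)\<^sup>2 + real p + 2"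
proof (induction k)
  case 0
  then show ?case by (simp add: local_count_1)
next
  case (Suc k)
  have "p \<ge> 1" using p prime_ge_1_nat by blast
  then have sq: "2 * real (card (unit_squares (int p ^ Suc k))) = real p ^ k * (real p - 1)"
    using arg_cong[OF card_unit_squares_odd_prime_power[OF p, of k], of real] by (simp add: of_nat_diff)
  have "real (local_count a (int p ^ Suc k)) * (2 * real p + 2) =
      real (local_count a (int p ^ k)) * (2 * real p + 2) +
      real p ^ Suc k * (2 * real (card (unit_squares (int p ^ Suc k)))) * (real p + 1)"
    unfolding local_count_prime_power_Suc[OF p(1) a] by (simp add: algebra_simps)
  also have "\<dots> = real p * (real p ^ Suc k)\<^sup>2 + real p + 2"
    unfolding Suc sq by (simp add: power2_eq_square algebra_simps)
  finally show ?case .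
qed

lemma local_count_two_small:
  assumes "odd a"
  shows "local_count a 2 = 3" "local_count a 4 = 7"
proof -
  have a: "coprime a (int 2)" using assms by simp
  show 2: "local_count a 2 = 3"
    using local_count_prime_power_Suc[OF two_is_prime_nat a, of 0]
    by (simp add: local_count_1 unit_squares_two)
  show "local_count a 4 = 7"
    using local_count_prime_power_Suc[OF two_is_prime_nat a, of 1] 2
    by (simp add: unit_squares_four)
qed

text \<open>The increments \<open>2^(2k+3)\<close> form a geometric series; the constant comes from
  the count \<open>7\<close> for the modulus \<open>4\<close>, since
  \<open>12 * 7 = 2 * 16 + 52\<close>.\<close>

lemma local_count_two_power:
  assumes "odd a"
  shows "12 * local_count a (2 ^ (k + 2)) = 2 * (2 ^ (k + 2))\<^sup>2 + 52"
proof (induction k)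
  case 0
  then show ?case using local_count_two_small[OF assms] by simp
next
  case (Suc k)
  have a: "coprime a (int 2)" using assms by simp
  have "local_count a (2 ^ (Suc k + 2)) = local_count a (2 ^ (k + 2)) + 2 ^ (k + 3) * 2 ^ k"
    using local_count_prime_power_Suc[OF two_is_prime_nat a, of "k + 2"] card_unit_squares_power_two[of k]
    by (simp add: numeral_3_eq_3)
  then show ?case using Suc by (simp add: power_add power2_eq_square)
qed

text \<open>Dividing the closed forms by the number \<open>p^(2k)\<close> of residues turns them
  into the explicit fractions. For \<open>p = 2\<close> the exponents \<open>0\<close> and
  \<open>1\<close> lie outside the closed form and are checked separately.\<close>

lemma local_factor_eq_local_count:
  fixes p :: nat
  assumes p: "prime p" and a: "coprime a (int p)"
  shows "local_factor p (2 * k) = real (local_count a (int p ^ k)) / real ((p ^ k)\<^sup>2)"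
proof (cases "p = 2")
  case False
  then have odd: "odd p" using p primes_dvd_imp_eq two_is_prime_nat by blast
  have p0: "real p > 0" using p prime_gt_0_nat by simp
  define P where "P = (real p ^ k)\<^sup>2"
  have P: "P > 0" using p0 by (simp add: P_def)
  have P': "real p ^ (2 * k) = P" by (simp add: P_def power_mult mult.commute[of 2 k])
  have e: "real p powi (- int (2 * k)) = 1 / P" "real p powi (1 - int (2 * k)) = real p / P"
    using p0 P' by (simp_all add: power_int_diff power_int_minus inverse_eq_divide del: of_nat_mult)
  have "real (local_count a (int p ^ k)) = (real p * P + real p + 2) / (2 * real p + 2)"
    using local_count_odd_prime_power[OF p odd a, of k] p0 by (simp add: P_def field_simps)
  moreover have "local_factor p (2 * k) = (real p + real p / P + 2 * (1 / P)) / (2 * real p + 2)"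
    using False e by (simp add: local_factor_def)
  moreover have "real p + real p / P + 2 * (1 / P) = (real p * P + real p + 2) / P"
    using P by (simp add: field_simps)
  ultimately have "local_factor p (2 * k) = real (local_count a (int p ^ k)) / P"
    by (simp add: mult.commute)
  then show ?thesis by (simp add: P_def)
next
  case True
  then have "odd a" using a by simp
  consider "k = 0" | "k = 1" | j where "k = j + 2" by (metis One_nat_def add_2_eq_Suc' not0_implies_Suc)
  then show ?thesis
  proof cases
    case 1
    then show ?thesis using True by (simp add: local_factor_def local_count_1)
  next
    case 2
    then show ?thesis using True local_count_two_small(1)[OF \<open>odd a\<close>] by (simp add: local_factor_def)
  next
    case 3
    define P where "P = ((2::real) ^ k)\<^sup>2"
    have P: "P > 0" by (simp add: P_def)
    have P': "(2::real) ^ (2 * k) = P" by (simp add: P_def power_mult mult.commute[of 2 k])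
    have e: "(2::real) powi (m - int (2 * k)) = 2 powi m / P" for m
      using P' by (simp add: power_int_diff del: of_nat_mult)
    \<comment> \<open>The numerators \<open>16 + 32 + 4\<close> add up to the constant
      \<open>52\<close> of \<open>local_count_two_power\<close>.\<close>
    have "local_factor p (2 * k) = (2 + 16 / P + 32 / P + 4 / P) / 12"
      unfolding local_factor_def e using True 3 by simp
    moreover have "real (12 * local_count a (2 ^ k)) = 2 * P + 52"
      using local_count_two_power[OF \<open>odd a\<close>, of j] by (simp add: 3 P_def)
    then have "real (local_count a (int p ^ k)) = (2 * P + 52) / 12" by (simp add: True)
    ultimately have "local_factor p (2 * k) = real (local_count a (int p ^ k)) / P"
      using P by (simp add: field_simps)
    then show ?thesis by (simp add: P_def True)
  qed
qed

section \<open>Represented integers\<close>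

text \<open>A primitive zero \<open>(r1, r2)\<close> is completed to a unimodular basis, which kills
  the \<open>y^2\<close> term. The discriminant is invariant, so the mixed coefficient is
  \<open>b\<close> or \<open>- b\<close>, and the sign is absorbed into \<open>y\<close>. A common
  divisor of \<open>a\<close> and \<open>b\<close> divides every value, so primitivity makes it a
  unit.\<close>

lemma isotropic_values_normal_form:
  assumes prim: "primitive_bqf A B C" and b: "b > 0" "discr A B C = b\<^sup>2"
  obtains a where "coprime a b" "range (bqf A B C) = {x * (a * x + b * y) |x y. True}"
proof -
  have "isotropic_bqf A B C" using b by (auto simp: isotropic_bqf_def)
  moreover have "discr A B C \<noteq> 0" using b by simp
  ultimately obtain s t where st: "(s, t) \<noteq> (0, 0)" "bqf A B C (s, t) = 0"
    using isotropic_bqf_iff_zero by (metis surj_pair)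
  define g where "g = gcd s t"
  have g: "g \<noteq> 0" using st(1) by (auto simp: g_def)
  define r1 r2 where "r1 = s div g" and "r2 = t div g"
  have sr: "s = g * r1" "t = g * r2" by (simp_all add: r1_def r2_def g_def)
  have "coprime r1 r2"
    unfolding r1_def r2_def g_def using st(1) by (intro div_gcd_coprime) auto
  then obtain s1 s2 where "s1 * r1 + s2 * r2 = 1"
    using bezout_int[of r1 r2] by (metis coprime_iff_gcd_eq_1)
  then obtain u1 u2 where det: "r1 * u2 - r2 * u1 = 1"
    by (metis add.commute mult.commute mult_minus_left diff_minus_eq_add uminus_add_conv_diff)
  have zero: "A * r1\<^sup>2 + B * r1 * r2 + C * r2\<^sup>2 = 0"
  proof -
    have "g\<^sup>2 * (A * r1\<^sup>2 + B * r1 * r2 + C * r2\<^sup>2) = 0"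
      using st(2) by (simp add: bqf_def sr power2_eq_square algebra_simps)
    then show ?thesis using g by simp
  qed
  define B' where "B' = 2 * A * r1 * u1 + B * (r1 * u2 + r2 * u1) + 2 * C * r2 * u2"
  define a where "a = A * u1\<^sup>2 + B * u1 * u2 + C * u2\<^sup>2"
  have val: "bqf A B C (r1 * y + u1 * x, r2 * y + u2 * x) = x * (a * x + B' * y)" for x y
  proof -
    have "bqf A B C (r1 * y + u1 * x, r2 * y + u2 * x) =
        (A * r1\<^sup>2 + B * r1 * r2 + C * r2\<^sup>2) * y\<^sup>2 + x * (a * x + B' * y)"
      by (simp add: bqf_def a_def B'_def power2_eq_square algebra_simps)
    then show ?thesis using zero by simp
  qed
  \<comment> \<open>The discriminant of the substituted form is the old one times the squared
    determinant.\<close>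
  have "B'\<^sup>2 = B'\<^sup>2 - 4 * (A * r1\<^sup>2 + B * r1 * r2 + C * r2\<^sup>2) * a" using zero by simp
  also have "\<dots> = (B\<^sup>2 - 4 * A * C) * (r1 * u2 - r2 * u1)\<^sup>2"
    by (simp add: B'_def a_def power2_eq_square algebra_simps)
  finally have "B'\<^sup>2 = b\<^sup>2" using b(2) det by (simp add: discr_def)
  then have B': "B' = b \<or> B' = - b" by (simp add: power2_eq_iff)
  have inv: "\<exists>x y. v = (r1 * y + u1 * x, r2 * y + u2 * x)" for v
  proof -
    obtain v1 v2 where v: "v = (v1, v2)" by (cases v)
    have "r1 * (u2 * v1 - u1 * v2) + u1 * (r1 * v2 - r2 * v1) = v1 * (r1 * u2 - r2 * u1)"
      "r2 * (u2 * v1 - u1 * v2) + u2 * (r1 * v2 - r2 * v1) = v2 * (r1 * u2 - r2 * u1)"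
      by (simp_all add: algebra_simps)
    then show ?thesis unfolding v det by (metis mult.right_neutral)
  qed
  obtain \<sigma> where \<sigma>: "B' = \<sigma> * b" "\<sigma> * \<sigma> = 1"
  proof -
    from B' show ?thesis using that[of 1] that[of "- 1"] by auto
  qed
  have "range (bqf A B C) = {x * (a * x + b * y) |x y. True}"
  proof (intro equalityI subsetI)
    fix n assume "n \<in> range (bqf A B C)"
    then obtain v where v: "n = bqf A B C v" by blast
    obtain x y where "v = (r1 * y + u1 * x, r2 * y + u2 * x)" using inv by blast
    then have "n = x * (a * x + b * (\<sigma> * y))" using v val[of y x] by (simp add: \<sigma>(1) mult_ac)
    then show "n \<in> {x * (a * x + b * y) |x y. True}" by blast
  next
    fix n assume "n \<in> {x * (a * x + b * y) |x y. True}"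
    then obtain x y where n: "n = x * (a * x + b * y)" by blast
    have "B' * (\<sigma> * y) = \<sigma> * \<sigma> * (b * y)" by (simp add: \<sigma>(1) mult_ac)
    then have "n = bqf A B C (r1 * (\<sigma> * y) + u1 * x, r2 * (\<sigma> * y) + u2 * x)"
      using n by (simp only: val \<sigma>(2) mult_1)
    then show "n \<in> range (bqf A B C)" by blast
  qed
  moreover have "coprime a b"
  proof (rule coprimeI)
    fix c assume c: "c dvd a" "c dvd b"
    have cv: "c dvd bqf A B C v" for v
    proof -
      obtain x y where "v = (r1 * y + u1 * x, r2 * y + u2 * x)" using inv by blast
      then have "bqf A B C v = x * (a * x + B' * y)" using val by simp
      moreover have "c dvd B'" using \<sigma>(1) c(2) by simp
      ultimately show ?thesis using c(1) by simp
    qed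
    \<comment> \<open>These three values recover all coefficients.\<close>
    have "bqf A B C (1, 0) = A" "bqf A B C (0, 1) = C" "bqf A B C (1, 1) = A + B + C"
      by (simp_all add: bqf_def)
    then have "c dvd A" "c dvd C" "c dvd A + B + C" using cv by metis+
    then have "c dvd A" "c dvd B" "c dvd C" by (metis dvd_add_left_iff dvd_add_right_iff)+
    then have "c dvd Gcd {A, B, C}" by (intro Gcd_greatest) auto
    then show "is_unit c" using prim unfolding primitive_bqf_def by (simp only:)
  qed
  ultimately show ?thesis using that by blast
qed

section \<open>Represented integers among the local values\<close>

lemma represented_imp_local:
  assumes "n = x * (a * x + b * y)"
  shows "n \<in> local_values a b"
proof -
  have "[n = x * (a * x + b * y)] (mod b\<^sup>2)" "[a * x + b * y = a * x] (mod b)"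
    using assms by (simp_all add: cong_def)
  then show ?thesis unfolding local_values_def by blast
qed

text \<open>Dividing by the common gcd \<open>e\<close> of \<open>x\<close>, \<open>z\<close> and \<open>b\<close> turns the local condition into
  \<open>n / e\<^sup>2 \<equiv> a x'\<^sup>2\<close> modulo \<open>b / e\<close> with \<open>x' = x / e\<close> a unit; a divisor \<open>d\<close> of \<open>n / e\<^sup>2\<close> in the
  class of \<open>x'\<close> then yields the representation with first factor \<open>e d\<close>.\<close>

lemma local_imp_represented:
  assumes b: "b > 0" and a: "coprime a b" and n: "n \<in> local_values a b"
    and div: "\<And>c g. 0 < c \<Longrightarrow> c dvd b \<Longrightarrow> coprime g c \<Longrightarrow>
      \<exists>d. d dvd n \<and> [d = g] (mod c) \<and> coprime d b"
  shows "\<exists>x y. n = x * (a * x + b * y)"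
proof -
  obtain x z where xz: "[n = x * z] (mod b\<^sup>2)" "[z = a * x] (mod b)"
    using n by (auto simp: local_values_def)
  define e where "e = gcd x b"
  have e0: "e > 0" using b by (simp add: e_def)
  define x1 b1 where "x1 = x div e" and "b1 = b div e"
  have x1: "x = e * x1" and b1: "b = e * b1" by (simp_all add: x1_def b1_def e_def)
  have b10: "b1 > 0" using b b1 e0 by (simp add: zero_less_mult_iff)
  have cop1: "coprime x1 b1"
    unfolding x1_def b1_def e_def using b by (intro div_gcd_coprime) auto
  have a1: "coprime a b1" using a b1 by simp
  \<comment> \<open>Although \<open>e\<close> is defined from \<open>x\<close> and \<open>b\<close>,
    it divides \<open>z\<close> too, because \<open>z\<close> is congruent to \<open>a * x\<close>
    modulo \<open>b\<close>.\<close>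
  have "e dvd z" using cong_dvd_modulus[OF xz(2), of e] x1 b1 by (simp add: cong_dvd_iff)
  then obtain z1 where z1: "z = e * z1" by blast
  have "e * b1 dvd e * (z1 - a * x1)"
    using xz(2) by (simp add: cong_iff_dvd_diff x1 z1 b1 algebra_simps)
  then have z1': "[z1 = a * x1] (mod b1)" using e0 by (simp add: cong_iff_dvd_diff)
  have "e\<^sup>2 dvd n - x * z"
    using xz(1) by (auto simp: cong_iff_dvd_diff b1 power_mult_distrib elim: dvd_mult_left)
  moreover have "e\<^sup>2 dvd x * z" by (simp add: x1 z1 power2_eq_square)
  ultimately have "e\<^sup>2 dvd n" by (metis dvd_diff_left_iff)
  then obtain n1 where n1: "n = e\<^sup>2 * n1" by blast
  have "n - x * z = e\<^sup>2 * (n1 - x1 * z1)" by (simp add: n1 x1 z1 power2_eq_square algebra_simps)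
  then have "b1\<^sup>2 dvd n1 - x1 * z1"
    using xz(1) e0 by (simp add: cong_iff_dvd_diff b1 power_mult_distrib)
  then have "[n1 = x1 * z1] (mod b1)"
    by (auto simp: cong_iff_dvd_diff power2_eq_square elim: dvd_mult_left)
  also have "[x1 * z1 = x1 * (a * x1)] (mod b1)" using z1' by (rule cong_scalar_left)
  finally have n1': "[n1 = x1 * (a * x1)] (mod b1)" .
  obtain d where d: "d dvd n" "[d = x1] (mod b1)" "coprime d b"
    using div[OF b10 _ cop1] b1 by auto
  \<comment> \<open>Coprimality of \<open>d\<close> to \<open>b\<close>, hence to \<open>e\<close>,
    turns a divisor of \<open>n\<close> into a divisor of \<open>n1\<close>.\<close>
  have "coprime d (e\<^sup>2)" using d(3) b1 by simp
  then have "d dvd n1" using d(1) n1 by (simp add: coprime_dvd_mult_right_iff)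
  then obtain m where m: "n1 = d * m" by blast
  have "[d * m = x1 * (a * x1)] (mod b1)" using n1' m by simp
  also have "[x1 * (a * x1) = d * (a * d)] (mod b1)"
    using d(2) by (intro cong_mult cong_scalar_left) (auto simp: cong_sym)
  finally have "[d * m = d * (a * d)] (mod b1)" .
  moreover have "coprime d b1" using d(3) b1 by simp
  ultimately have "[m = a * d] (mod b1)" using cong_mult_lcancel by blast
  then obtain y where y: "m = a * d + b1 * y"
    by (metis cong_iff_lin cong_sym)
  have "n = (e * d) * (a * (e * d) + b * y)"
    by (simp add: n1 m y b1 power2_eq_square algebra_simps)
  then show ?thesis by blast
qed

text \<open>A local value that is not represented must lack a suitable divisor in some unit class
  modulo some divisor of \<open>b\<close>. These classes are finite in number and all rich, and each
  receives an equal share of the tolerance.\<close>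

lemma nonrepresented_local_values_sparse:
  assumes b: "b > 0" and a: "coprime a b" and \<epsilon>: "\<epsilon> > 0"
  shows "\<forall>\<^sub>F N in sequentially. real (sym_count
    (local_values a b - {x * (a * x + b * y) |x y. True}) N) / (2 * real N) < \<epsilon>"
proof -
  define I where "I = {(c, g). c \<in> {1..b} \<and> g \<in> {0..<c} \<and> coprime g c}"
  have finI: "finite I"
    by (rule finite_subset[of _ "{1..b} \<times> {0..<b}"]) (auto simp: I_def)
  \<comment> \<open>Nonemptiness of \<open>I\<close> allows the division defining
    \<open>\<eta>\<close> and makes the final sum of bounds strict.\<close>
  have "(1, 0) \<in> I" using b by (auto simp: I_def)
  then have cI: "real (card I) > 0" using finI card_gt_0_iff by force
  define \<eta> where "\<eta> = \<epsilon> / real (card I)"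
  have \<eta>: "\<eta> > 0" using \<epsilon> cI by (simp add: \<eta>_def)
  have "\<forall>i\<in>I. \<exists>D. (\<forall>d\<in>D. [d = snd i] (mod fst i) \<and> coprime d b) \<and>
     (\<forall>\<^sub>F N in sequentially. real (sym_count {n. \<forall>d\<in>D. \<not> d dvd n} N) / (2 * real N) < \<eta>)"
  proof
    fix i assume "i \<in> I"
    then have "rich_class (fst i) (snd i)" by (intro rich_class_coprime) (auto simp: I_def)
    then obtain D where "finite D \<and>
      (\<forall>d\<in>D. 0 < d \<and> [d = snd i] (mod fst i) \<and> coprime d b) \<and>
      (\<forall>\<^sub>F N in sequentially. real (sym_count {n. \<forall>d\<in>D. \<not> d dvd n} N) / (2 * real N) < \<eta>)"
      using \<eta> b unfolding rich_class_def by presburger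
    then show "\<exists>D. (\<forall>d\<in>D. [d = snd i] (mod fst i) \<and> coprime d b) \<and>
      (\<forall>\<^sub>F N in sequentially. real (sym_count {n. \<forall>d\<in>D. \<not> d dvd n} N) / (2 * real N) < \<eta>)"
      by (intro exI[of _ D]) simp
  qed
  from bchoice[OF this] obtain D where D: "\<And>i d. i \<in> I \<Longrightarrow> d \<in> D i \<Longrightarrow> [d = snd i] (mod fst i) \<and> coprime d b"
     "\<And>i. i \<in> I \<Longrightarrow> \<forall>\<^sub>F N in sequentially.
        real (sym_count {n. \<forall>d\<in>D i. \<not> d dvd n} N) / (2 * real N) < \<eta>"
    by blast
  have sub: "local_values a b - {x * (a * x + b * y) |x y. True} \<subseteq>
      (\<Union>i\<in>I. {n. \<forall>d\<in>D i. \<not> d dvd n})"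
  proof
    fix n assume n: "n \<in> local_values a b - {x * (a * x + b * y) |x y. True}"
    show "n \<in> (\<Union>i\<in>I. {n. \<forall>d\<in>D i. \<not> d dvd n})"
    proof (rule ccontr)
      assume "n \<notin> (\<Union>i\<in>I. {n. \<forall>d\<in>D i. \<not> d dvd n})"
      then have ex: "\<exists>d\<in>D i. d dvd n" if "i \<in> I" for i using that by blast
      have "\<exists>x y. n = x * (a * x + b * y)"
      proof (rule local_imp_represented[OF b a])
        show "n \<in> local_values a b" using n by simp
        fix c g :: int assume c: "0 < c" "c dvd b" "coprime g c"
        have "c \<le> b" using c b by (intro zdvd_imp_le)
        moreover have "coprime (g mod c) c" using c by (simp add: coprime_mod_left_iff)
        ultimately have i: "(c, g mod c) \<in> I" using c by (auto simp: I_def)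
        then obtain d where "d \<in> D (c, g mod c)" "d dvd n" using ex by blast
        moreover from this have "[d = g] (mod c)" "coprime d b"
          using D(1)[OF i] by (auto simp: cong_def)
        ultimately show "\<exists>d. d dvd n \<and> [d = g] (mod c) \<and> coprime d b" by blast
      qed
      then show False using n by blast
    qed
  qed
  have "\<forall>\<^sub>F N in sequentially. \<forall>i\<in>I.
      real (sym_count {n. \<forall>d\<in>D i. \<not> d dvd n} N) / (2 * real N) < \<eta>"
    using finI D(2) by (simp add: eventually_ball_finite_distrib)
  then show ?thesis
  proof eventually_elim
    case (elim N)
    have "sym_count (local_values a b - {x * (a * x + b * y) |x y. True}) N \<le>
        (\<Sum>i\<in>I. sym_count {n. \<forall>d\<in>D i. \<not> d dvd n} N)"
      by (rule order.trans[OF sym_count_mono[OF sub] sym_count_UN[OF finI]])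
    then have "real (sym_count (local_values a b - {x * (a * x + b * y) |x y. True}) N) \<le>
        real (\<Sum>i\<in>I. sym_count {n. \<forall>d\<in>D i. \<not> d dvd n} N)"
      by (simp only: of_nat_le_iff)
    then have "real (sym_count (local_values a b - {x * (a * x + b * y) |x y. True}) N) / (2 * real N)
        \<le> (\<Sum>i\<in>I. real (sym_count {n. \<forall>d\<in>D i. \<not> d dvd n} N) / (2 * real N))"
      by (simp add: divide_right_mono flip: sum_divide_distrib)
    also have "\<dots> < (\<Sum>i\<in>I. \<eta>)"
      using elim finI \<open>(1, 0) \<in> I\<close> by (intro sum_strict_mono) auto
    also have "\<dots> = \<epsilon>" using cI by (simp add: \<eta>_def)
    finally show ?case .
  qed
qed

text \<open>Represented integers are local values, whose density comes from periodicity. The loss is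
  a set of density zero and the single integer \<open>0\<close>, which costs
  \<open>1 / (2 N)\<close>; a sandwich concludes.\<close>

lemma represented_density:
  assumes b: "b > 0" and a: "coprime a b"
  shows "(\<lambda>N. real (sym_count ({x * (a * x + b * y) |x y. True} - {0}) N) / (2 * real N))
    \<longlonglongrightarrow> real (local_count a b) / real_of_int (b\<^sup>2)"
proof -
  let ?S = "{x * (a * x + b * y) |x y. True}"
  let ?T = "local_values a b"
  let ?q = "\<lambda>S N. real (sym_count S N) / (2 * real N)"
  have ST: "?S \<subseteq> ?T" using represented_imp_local by blast
  have T: "?q ?T \<longlonglongrightarrow> real (local_count a b) / real_of_int (b\<^sup>2)"
    unfolding local_count_def using b by (intro periodic_density local_values_periodic) auto
  have bad: "?q (?T - ?S) \<longlonglongrightarrow> 0"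
  proof (rule order_tendstoI)
    fix \<epsilon> :: real assume "\<epsilon> > 0"
    then show "\<forall>\<^sub>F N in sequentially. ?q (?T - ?S) N < \<epsilon>"
      by (rule nonrepresented_local_values_sparse[OF b a])
  next
    fix \<epsilon> :: real assume "\<epsilon> < 0"
    then show "\<forall>\<^sub>F N in sequentially. \<epsilon> < ?q (?T - ?S) N"
      by (intro always_eventually allI) (simp add: order.strict_trans2)
  qed
  have "(\<lambda>N. ?q ?T N - ?q (?T - ?S) N - 1 / (2 * real N)) \<longlonglongrightarrow>
      real (local_count a b) / real_of_int (b\<^sup>2) - 0 - 0"
    by (intro tendsto_diff T bad) real_asymp
  then have low: "(\<lambda>N. ?q ?T N - ?q (?T - ?S) N - 1 / (2 * real N)) \<longlonglongrightarrow>
      real (local_count a b) / real_of_int (b\<^sup>2)" by simp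
  show ?thesis
  proof (rule tendsto_sandwich[OF _ _ low T])
    show "\<forall>\<^sub>F N in sequentially. ?q ?T N - ?q (?T - ?S) N - 1 / (2 * real N) \<le> ?q (?S - {0}) N"
    proof (intro always_eventually allI)
      fix N
      have "?T \<subseteq> (?S - {0}) \<union> ((?T - ?S) \<union> {0})" by blast
      then have "sym_count ?T N \<le> sym_count (?S - {0}) N + (sym_count (?T - ?S) N + sym_count {0} N)"
        using sym_count_mono sym_count_Un by (meson add_left_mono order.trans)
      moreover have "sym_count {0} N = 1" by (simp add: sym_count_def)
      ultimately have "real (sym_count ?T N) - real (sym_count (?T - ?S) N) - 1
          \<le> real (sym_count (?S - {0}) N)" by linarith
      then show "?q ?T N - ?q (?T - ?S) N - 1 / (2 * real N) \<le> ?q (?S - {0}) N"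
        by (simp only: diff_divide_distrib[symmetric] divide_right_mono of_nat_0_le_iff
            mult_nonneg_nonneg zero_le_numeral)
    qed
    show "\<forall>\<^sub>F N in sequentially. ?q (?S - {0}) N \<le> ?q ?T N"
      using ST by (intro always_eventually allI divide_right_mono of_nat_mono sym_count_mono) auto
  qed
qed

section \<open>The product formula\<close>

lemma local_density_eq_prod:
  fixes b :: nat
  assumes b: "b > 0" and a: "coprime a (int b)"
  shows "real (local_count a (int b)) / real (b\<^sup>2) =
    (\<Prod>p\<in>prime_factors b. local_factor p (2 * multiplicity p b))"
proof -
  let ?f = "\<lambda>p. p ^ multiplicity p b"
  \<comment> \<open>Generalising to partial products over sets \<open>P\<close> of prime factors
    lets one prime at a time split off by multiplicativity.\<close>
  have "real (local_count a (int (\<Prod>p\<in>P. ?f p))) / real ((\<Prod>p\<in>P. ?f p)\<^sup>2) =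
      (\<Prod>p\<in>P. local_factor p (2 * multiplicity p b))"
    if "finite P" "P \<subseteq> prime_factors b" for P
    using that
  proof (induction P rule: finite_induct)
    case empty
    then show ?case by (simp add: local_count_1)
  next
    case (insert p P)
    have p: "prime p" "p dvd b" using insert.prems by auto
    have "coprime a (int p)" using a p(2) by (metis coprime_commute coprime_divisors dvd_refl of_nat_dvd_iff)
    then have lf: "real (local_count a (int (?f p))) / real ((?f p)\<^sup>2) =
        local_factor p (2 * multiplicity p b)"
      using local_factor_eq_local_count[OF p(1)] by simp
    have "coprime p r" if "r \<in> P" for r
      using that insert.hyps insert.prems p by (intro primes_coprime) auto
    then have "coprime (?f p) (\<Prod>p\<in>P. ?f p)"
      by (intro prod_coprime_right) simp
    then have cop: "coprime (int (?f p)) (int (\<Prod>p\<in>P. ?f p))"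
      by (simp only: coprime_int_iff)
    have "r > 0" if "r \<in> insert p P" for r
      using that insert.prems in_prime_factors_imp_prime prime_gt_0_nat by blast
    then have "?f p > 0" "(\<Prod>p\<in>P. ?f p) > 0" by (auto intro!: prod_pos)
    then have pos: "int (?f p) > 0" "int (\<Prod>p\<in>P. ?f p) > 0" by (simp_all only: of_nat_0_less_iff)
    have "local_count a (int (\<Prod>p\<in>insert p P. ?f p)) =
        local_count a (int (?f p)) * local_count a (int (\<Prod>p\<in>P. ?f p))"
      using local_count_mult[OF cop pos, of a] insert.hyps by simp
    then have "real (local_count a (int (\<Prod>p\<in>insert p P. ?f p))) / real ((\<Prod>p\<in>insert p P. ?f p)\<^sup>2) =
        real (local_count a (int (?f p))) / real ((?f p)\<^sup>2) *
        (real (local_count a (int (\<Prod>p\<in>P. ?f p))) / real ((\<Prod>p\<in>P. ?f p)\<^sup>2))"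
      using insert.hyps by (simp add: power_mult_distrib)
    also have "\<dots> = (\<Prod>p\<in>insert p P. local_factor p (2 * multiplicity p b))"
      unfolding lf using insert by simp
    finally show ?case .
  qed
  from this[of "prime_factors b"] show ?thesis
    using prod_prime_factors[of b] b by simp
qed

lemma multiplicity_of_nat_int: "multiplicity (int p) (int m) = multiplicity p m"
  by (simp add: multiplicity_def flip: of_nat_power)

lemma local_factor_pos: "p > 0 \<Longrightarrow> local_factor p a > 0"
  by (auto simp: local_factor_def intro!: divide_pos_pos add_pos_pos)

lemma local_factor_eq_1_iff:
  assumes p: "prime p" and a: "even a"
  shows "local_factor p a = 1 \<longleftrightarrow> a = 0"
proof (cases "p = 2")
  case True
  have "local_factor 2 a \<noteq> 1" if "a \<noteq> 0"
  proof (cases "a = 2")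
    case False
    then have "a \<ge> 4" using a that by presburger
    \<comment> \<open>The three powers are at most \<open>1\<close>, \<open>2\<close> and
      \<open>1\<close>, so the numerator is at most \<open>6\<close>.\<close>
    then have "(2::real) powi (4 - int a) \<le> 2 powi 0" "(2::real) powi (5 - int a) \<le> 2 powi 1"
        "(2::real) powi (2 - int a) \<le> 2 powi 0"
      by (intro power_int_increasing; simp)+
    then show ?thesis using False that by (simp add: local_factor_def)
  qed (simp add: local_factor_def)
  then show ?thesis using True by (auto simp: local_factor_def)
next
  case False
  have p1: "real p > 1" using prime_gt_1_nat[OF p] by simp
  have "local_factor p a < 1" if "a \<noteq> 0"
  proof -
    \<comment> \<open>The numerator is then less than \<open>p + 3\<close>, which is below
      \<open>2 p + 2\<close>.\<close>
    have "real p powi (1 - int a) \<le> real p powi 0" "real p powi (- int a) < real p powi 0"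
      using p1 that by (intro power_int_increasing power_int_strict_increasing; simp)+
    then show ?thesis using False p1 by (simp add: local_factor_def)
  qed
  moreover have "local_factor p 0 = 1" using False p1 by (simp add: local_factor_def field_simps)
  ultimately show ?thesis by fastforce
qed

text \<open>As \<open>form_density\<close> is defined by \<open>lim\<close>, the first conjunct
  supplies the existence of that limit. In the infinite product the indices that are not prime carry
  the factor \<open>1\<close>.\<close>

theorem theorem1p6:
  fixes A B C :: int
  assumes "primitive_bqf A B C"
    and "discr A B C \<noteq> 0"
    and "isotropic_bqf A B C"
  shows "has_density (nonzero_values (bqf A B C)) (form_density (bqf A B C))
    \<and> form_density (bqf A B C) > 0
    \<and> (\<forall>p. prime p \<longrightarrow> even (discr_val A B C p))
    \<and> (\<lambda>p. if prime p then form_factor A B C p else 1) has_prod form_density (bqf A B C)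
    \<and> (\<forall>p. prime p \<longrightarrow> (form_factor A B C p = 1 \<longleftrightarrow> discr_val A B C p = 0))
    \<and> form_density (bqf A B C) = (\<Prod>p | prime p \<and> int p dvd discr A B C. form_factor A B C p)"
proof -
  obtain b where b: "b > 0" "discr A B C = b\<^sup>2"
    using assms(3) by (auto simp: isotropic_bqf_def)
  define m where "m = nat b"
  have bm: "b = int m" and m: "m > 0" using b(1) by (simp_all add: m_def)
  obtain a where a: "coprime a b"
    and range: "range (bqf A B C) = {x * (a * x + b * y) |x y. True}"
    using isotropic_values_normal_form[OF assms(1) b] by blast
  let ?S = "nonzero_values (bqf A B C)"
  let ?\<delta> = "real (local_count a b) / real_of_int (b\<^sup>2)"
  have S: "?S = {x * (a * x + b * y) |x y. True} - {0}"
    by (simp add: nonzero_values_def range)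
  \<comment> \<open>Taking \<open>x = 1\<close> gives the values \<open>a + b * y\<close>; since
    \<open>b * k\<close> exceeds the absolute value of \<open>a\<close>, the choices
    \<open>y = k\<close> and \<open>y = - k\<close> yield both signs.\<close>
  define k where "k = \<bar>a\<bar> + 1"
  have "b * k \<ge> k" using b by (simp add: k_def)
  moreover have "a + k > 0" "a - k < 0" by (auto simp: k_def)
  ultimately have big: "a + b * k > 0" "a + b * (- k) < 0"
    by (simp_all only: mult_minus_right)
  have mem: "1 * (a * 1 + b * y) \<in> range (bqf A B C)" for y unfolding range by blast
  have "a + b * k \<in> ?S" "a + b * (- k) \<in> ?S"
    using mem[of k] mem[of "- k"] big by (auto simp: nonzero_values_def)
  then have "\<not> positive_set ?S" "\<not> negative_set ?S"
    using big unfolding positive_set_def negative_set_def by blast+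
  then have "density_quotient ?S = (\<lambda>N. real (sym_count ?S N) / (2 * real N))"
    by (auto simp: density_quotient_def sym_count_def)
  then have lim: "density_quotient ?S \<longlonglongrightarrow> ?\<delta>"
    using represented_density[OF b(1) a] by (simp add: S)
  then have \<delta>: "form_density (bqf A B C) = ?\<delta>"
    by (simp add: form_density_def set_density_def limI)
  have val: "discr_val A B C p = 2 * multiplicity p m" if "prime p" for p
  proof -
    have "multiplicity (int p) ((int m)\<^sup>2) = 2 * multiplicity (int p) (int m)"
      using that m by (subst prime_elem_multiplicity_power_distrib) auto
    then show ?thesis by (simp add: discr_val_def b(2) bm multiplicity_of_nat_int)
  qed
  have P: "{p. prime p \<and> int p dvd discr A B C} = prime_factors m"
  proof -
    have "int p dvd b\<^sup>2 \<longleftrightarrow> p dvd m" if "prime p" for p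
      using that prime_dvd_power_iff[of "int p" 2 b] by (simp add: bm)
    then show ?thesis using m by (auto simp: b(2) in_prime_factors_iff)
  qed
  have "?\<delta> = (\<Prod>p\<in>prime_factors m. local_factor p (2 * multiplicity p m))"
    using local_density_eq_prod[OF m, of a] a by (simp add: bm)
  also have "\<dots> = (\<Prod>p\<in>prime_factors m. form_factor A B C p)"
    by (intro prod.cong) (auto simp: form_factor_def val in_prime_factors_imp_prime)
  finally have prod: "form_density (bqf A B C) = (\<Prod>p\<in>prime_factors m. form_factor A B C p)"
    by (simp add: \<delta>)
  have pos: "form_factor A B C p > 0" if "prime p" for p
    using that by (simp add: form_factor_def local_factor_pos prime_gt_0_nat)
  have iff: "form_factor A B C p = 1 \<longleftrightarrow> discr_val A B C p = 0" if "prime p" for p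
    using local_factor_eq_1_iff[OF that, of "discr_val A B C p"] val[OF that]
    by (simp add: form_factor_def)
  \<comment> \<open>At primes not dividing \<open>m\<close> the valuation is zero and the factor is
    \<open>1\<close>, so the infinite product is really finite.\<close>
  have "(\<lambda>p. if prime p then form_factor A B C p else 1) has_prod
      (\<Prod>p\<in>prime_factors m. if prime p then form_factor A B C p else 1)"
  proof (rule has_prod_finite)
    fix p assume "p \<notin> prime_factors m"
    then have "multiplicity p m = 0" if "prime p"
      using that m by (simp add: in_prime_factors_iff not_dvd_imp_multiplicity_0)
    then show "(if prime p then form_factor A B C p else 1) = 1" using iff val by simp
  qed simp
  also have "(\<Prod>p\<in>prime_factors m. if prime p then form_factor A B C p else 1) =
      form_density (bqf A B C)"
    unfolding prod by (intro prod.cong) (auto simp: in_prime_factors_imp_prime)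
  finally have has_prod: "(\<lambda>p. if prime p then form_factor A B C p else 1) has_prod
      form_density (bqf A B C)" .
  have "form_density (bqf A B C) > 0"
    unfolding prod using pos by (intro prod_pos) (auto simp: in_prime_factors_imp_prime)
  then show ?thesis
    using lim \<delta> has_prod iff val prod P by (simp add: has_density_def)
qed

end
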